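(* Let $\gamma:I\to\mathbb{G}$ be a unit speed Frenet curve and let $\beta$ be its natural mate, with Frenet-Serret apparatus $\{\overline T,\overline N,\overline B,\overline\kappa,\overline\tau\}$. Then $\gamma$ is a general helix if and only if $\overline\tau-\overline{\tau_{\mathbb G}}=0$, where $\overline{\tau_{\mathbb G}}=\frac12\langle[\overline T,\overline N],\overline B\rangle$.
   Context: Let $\mathbb{G}$ be a three-dimensional Lie group with a bi-invariant Riemannian metric $\langle\cdot,\cdot\rangle$, with (oriented) Lie algebra $\mathfrak g$ and Levi-Civita connection $\nabla$; $I\subset\mathbb R$ is an interval and curves are smooth. Vector fields along a curve in $\mathbb G$ are identified with $\mathfrak g$-valued maps by left translation: fixing an orthonormal basis $X_1,X_2,X_3$ of left-invariant fields, write $U=\sum u_iX_i$, and set $U'=\sum u_i'X_i$, $[U,V]=\sum u_iv_j[X_i,X_j]$; then $\nabla_TU=U'+\frac12[T,U]$ with $T=\gamma'$. Vector fields along different curves with the same parameter interval are compared as $\mathfrak g$-valued maps. A unit speed curve $\gamma$ has Frenet-Serret apparatus $\{T,N,B,\kappa,\tau\}$ if $\kappa=\|\nabla_TT\|>0$, $(T,N,B)$ is a positively oriented orthonormal frame, and $\nabla_TT=\kappa N$, $\nabla_TN=-\kappa T+\tau B$, $\nabla_TB=-\tau N$. It is a Frenet curve if moreover $\tau\neq0$. The Lie group torsion is $\tau_{\mathbb G}=\frac12\langle[T,N],B\rangle$; the harmonic curvature is $H=(\tau-\tau_{\mathbb G})/\kappa$. A unit speed curve $\beta:I\to\mathbb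 G$ with Frenet-Serret apparatus $\{\overline T,\overline N,\overline B,\overline\kappa,\overline\tau\}$ is the natural mate of $\gamma$ if $\overline T=N$. A curve is a general helix if and only if its harmonic curvature function $H$ is constant (the characterization used throughout, taken as the definition). *)

theory Defs
  imports "HOL-Analysis.Analysis" "HOL-Algebra.Group"
begin

section \<open>Smooth maps, atlases, Lie groups\<close>

(* Derivatives are taken within S, so that S may be an open set or a (relatively open part of a)
   nondegenerate interval of the real line; in the latter case derivatives at endpoints are
   one-sided. These are the only uses below, and derivatives within S are unique there. *)
primrec Ck_on :: "nat \<Rightarrow> 'a::real_normed_vector set \<Rightarrow> ('a \<Rightarrow> 'b::real_normed_vector) \<Rightarrow> bool" where
  "Ck_on 0 S f \<longleftrightarrow> continuous_on S f"
| "Ck_on (Suc k) S f \<longleftrightarrow> f differentiable_on S \<and>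
     (\<forall>v. Ck_on k S (\<lambda>x. frechet_derivative f (at x within S) v))"

definition smooth_on :: "'a::real_normed_vector set \<Rightarrow> ('a \<Rightarrow> 'b::real_normed_vector) \<Rightarrow> bool" where
  "smooth_on S f \<longleftrightarrow> (\<forall>k. Ck_on k S f)"

type_synonym ('g, 'e) chart = "'g set \<times> ('g \<Rightarrow> 'e)"

(* The manifold is the whole type 'g; Hausdorff and second countable come from the type class.
   The dimension is that of the model space 'e. *)
definition smooth_atlas ::
  "('g::{t2_space, second_countable_topology}, 'e::euclidean_space) chart set \<Rightarrow> bool" where
  "smooth_atlas A \<longleftrightarrow>
     (\<Union>(U, \<phi>)\<in>A. U) = UNIV \<and>
     (\<forall>(U, \<phi>)\<in>A. open U \<and> open (\<phi> ` U) \<and> homeomorphism U (\<phi> ` U) \<phi> (inv_into U \<phi>)) \<and>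
     (\<forall>(U, \<phi>)\<in>A. \<forall>(V, \<psi>)\<in>A. smooth_on (\<phi> ` (U \<inter> V)) (\<psi> \<circ> inv_into U \<phi>))"

definition prod_atlas ::
  "('g, 'e) chart set \<Rightarrow> ('h, 'f) chart set \<Rightarrow> ('g \<times> 'h, 'e \<times> 'f) chart set" where
  "prod_atlas A B = {(U \<times> V, map_prod \<phi> \<psi>) | U \<phi> V \<psi>. (U, \<phi>) \<in> A \<and> (V, \<psi>) \<in> B}"

definition smooth_map ::
  "('g::topological_space, 'e::euclidean_space) chart set \<Rightarrow>
   ('h::topological_space, 'f::euclidean_space) chart set \<Rightarrow> ('g \<Rightarrow> 'h) \<Rightarrow> bool" where
  "smooth_map A B h \<longleftrightarrow> continuous_on UNIV h \<and>
     (\<forall>(U, \<phi>)\<in>A. \<forall>(V, \<psi>)\<in>B. smooth_on (\<phi> ` (U \<inter> h -` V)) (\<psi> \<circ> h \<circ> inv_into U \<phi>))"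

definition lie_group ::
  "('g::{t2_space, second_countable_topology}) monoid \<Rightarrow> ('g, 'e::euclidean_space) chart set \<Rightarrow> bool" where
  "lie_group G A \<longleftrightarrow> group G \<and> carrier G = UNIV \<and> smooth_atlas A \<and>
     smooth_map (prod_atlas A A) A (\<lambda>(x, y). x \<otimes>\<^bsub>G\<^esub> y) \<and>
     smooth_map A A (\<lambda>x. inv\<^bsub>G\<^esub> x)"


section \<open>Tangent vectors and vector fields\<close>

(* Smooth on some neighbourhood of p. *)
definition smooth_at ::
  "('g::topological_space, 'e::euclidean_space) chart set \<Rightarrow> 'g \<Rightarrow> ('g \<Rightarrow> real) \<Rightarrow> bool" where
  "smooth_at A p f \<longleftrightarrow> (\<exists>W. open W \<and> p \<in> W \<and>
     (\<forall>(U, \<phi>)\<in>A. smooth_on (\<phi> ` (U \<inter> W)) (f \<circ> inv_into U \<phi>)))"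

definition smooth_curve ::
  "('g::topological_space, 'e::euclidean_space) chart set \<Rightarrow> real set \<Rightarrow> (real \<Rightarrow> 'g) \<Rightarrow> bool" where
  "smooth_curve A I c \<longleftrightarrow> continuous_on I c \<and> (\<forall>(U, \<phi>)\<in>A. smooth_on (I \<inter> c -` U) (\<phi> \<circ> c))"

(* A tangent vector at p is the directional derivative it induces on functions smooth near p;
   it is set to 0 on all other functions, so that equality of functionals is equality of tangent
   vectors. Every tangent vector is the velocity of a curve. *)
type_synonym 'g tvec = "('g \<Rightarrow> real) \<Rightarrow> real"

definition velocity ::
  "('g::topological_space, 'e::euclidean_space) chart set \<Rightarrow> real set \<Rightarrow> (real \<Rightarrow> 'g) \<Rightarrow> real \<Rightarrow> 'g tvec" where
  "velocity A I c t =
     (\<lambda>f. if smooth_at A (c t) f then vector_derivative (f \<circ> c) (at t within I) else 0)"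

definition tangent_space ::
  "('g::topological_space, 'e::euclidean_space) chart set \<Rightarrow> 'g \<Rightarrow> 'g tvec set" where
  "tangent_space A p =
     {velocity A {-e<..<e} c 0 | e c. e > 0 \<and> smooth_curve A {-e<..<e} c \<and> c 0 = p}"

definition vector_field ::
  "('g::topological_space, 'e::euclidean_space) chart set \<Rightarrow> ('g \<Rightarrow> 'g tvec) \<Rightarrow> bool" where
  "vector_field A X \<longleftrightarrow> (\<forall>p. X p \<in> tangent_space A p) \<and>
     (\<forall>f p. smooth_at A p f \<longrightarrow> smooth_at A p (\<lambda>q. X q f))"

definition lie_bracket ::
  "('g::topological_space, 'e::euclidean_space) chart set \<Rightarrow>
   ('g \<Rightarrow> 'g tvec) \<Rightarrow> ('g \<Rightarrow> 'g tvec) \<Rightarrow> 'g \<Rightarrow> 'g tvec" where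
  "lie_bracket A X Y p =
     (\<lambda>f. if smooth_at A p f then X p (\<lambda>q. Y q f) - Y p (\<lambda>q. X q f) else 0)"

(* The differential of h applied to the tangent vector u; used for diffeomorphisms h only. *)
definition push :: "('g \<Rightarrow> 'g) \<Rightarrow> 'g tvec \<Rightarrow> 'g tvec" where
  "push h u = (\<lambda>f. u (f \<circ> h))"

definition lie_algebra ::
  "('g::topological_space) monoid \<Rightarrow> ('g, 'e::euclidean_space) chart set \<Rightarrow> ('g \<Rightarrow> 'g tvec) set" where
  "lie_algebra G A =
     {X. vector_field A X \<and> (\<forall>a p. X (a \<otimes>\<^bsub>G\<^esub> p) = push (\<lambda>x. a \<otimes>\<^bsub>G\<^esub> x) (X p))}"


section \<open>Bi-invariant metrics and the Levi-Civita connection\<close>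

type_synonym 'g metric = "'g \<Rightarrow> 'g tvec \<Rightarrow> 'g tvec \<Rightarrow> real"

definition riemannian_metric ::
  "('g::topological_space, 'e::euclidean_space) chart set \<Rightarrow> 'g metric \<Rightarrow> bool" where
  "riemannian_metric A m \<longleftrightarrow>
     (\<forall>p. \<forall>u\<in>tangent_space A p. \<forall>v\<in>tangent_space A p. m p u v = m p v u) \<and>
     (\<forall>p. \<forall>u\<in>tangent_space A p. \<forall>v\<in>tangent_space A p. \<forall>w\<in>tangent_space A p. \<forall>a b.
        m p (\<lambda>f. a * u f + b * v f) w = a * m p u w + b * m p v w) \<and>
     (\<forall>p. \<forall>u\<in>tangent_space A p. u \<noteq> (\<lambda>f. 0) \<longrightarrow> m p u u > 0) \<and>
     (\<forall>X Y. vector_field A X \<longrightarrow> vector_field A Y \<longrightarrow> (\<forall>p. smooth_at A p (\<lambda>q. m q (X q) (Y q))))"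

definition bi_invariant ::
  "('g::topological_space) monoid \<Rightarrow> ('g, 'e::euclidean_space) chart set \<Rightarrow> 'g metric \<Rightarrow> bool" where
  "bi_invariant G A m \<longleftrightarrow>
     (\<forall>a p. \<forall>u\<in>tangent_space A p. \<forall>v\<in>tangent_space A p.
        m (a \<otimes>\<^bsub>G\<^esub> p) (push (\<lambda>x. a \<otimes>\<^bsub>G\<^esub> x) u) (push (\<lambda>x. a \<otimes>\<^bsub>G\<^esub> x) v) = m p u v \<and>
        m (p \<otimes>\<^bsub>G\<^esub> a) (push (\<lambda>x. x \<otimes>\<^bsub>G\<^esub> a) u) (push (\<lambda>x. x \<otimes>\<^bsub>G\<^esub> a) v) = m p u v)"

type_synonym 'g connection = "('g \<Rightarrow> 'g tvec) \<Rightarrow> ('g \<Rightarrow> 'g tvec) \<Rightarrow> 'g \<Rightarrow> 'g tvec"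

definition levi_civita ::
  "('g::topological_space, 'e::euclidean_space) chart set \<Rightarrow> 'g metric \<Rightarrow> 'g connection \<Rightarrow> bool" where
  "levi_civita A m nabla \<longleftrightarrow>
     (\<forall>X Y. vector_field A X \<longrightarrow> vector_field A Y \<longrightarrow>
        vector_field A (nabla X Y) \<and>
        (\<forall>p f. nabla X Y p f - nabla Y X p f = lie_bracket A X Y p f)) \<and>
     (\<forall>X Y Z h. vector_field A X \<longrightarrow> vector_field A Y \<longrightarrow> vector_field A Z \<longrightarrow>
        (\<forall>p. smooth_at A p h) \<longrightarrow>
        (\<forall>p f.
          nabla (\<lambda>q g. X q g + Y q g) Z p f = nabla X Z p f + nabla Y Z p f \<and>
          nabla (\<lambda>q g. h q * X q g) Z p f = h p * nabla X Z p f \<and>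
          nabla X (\<lambda>q g. Y q g + Z q g) p f = nabla X Y p f + nabla X Z p f \<and>
          nabla X (\<lambda>q g. h q * Y q g) p f = h p * nabla X Y p f + X p h * Y p f)) \<and>
     (\<forall>X Y Z. vector_field A X \<longrightarrow> vector_field A Y \<longrightarrow> vector_field A Z \<longrightarrow>
        (\<forall>p. X p (\<lambda>q. m q (Y q) (Z q)) = m p (nabla X Y p) (Z p) + m p (Y p) (nabla X Z p)))"


section \<open>Left-invariant frames and vector fields along curves\<close>

(* A basis X of the Lie algebra, orthonormal for the metric at the identity. The orientation of the
   Lie algebra is the one for which X is positively oriented. *)
definition orthonormal_basis ::
  "('g::topological_space) monoid \<Rightarrow> ('g, real^3) chart set \<Rightarrow> 'g metric \<Rightarrow> (3 \<Rightarrow> 'g \<Rightarrow> 'g tvec) \<Rightarrow> bool" where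
  "orthonormal_basis G A m X \<longleftrightarrow>
     (\<forall>i. X i \<in> lie_algebra G A) \<and>
     (\<forall>Y\<in>lie_algebra G A. \<exists>y::real^3. \<forall>p f. Y p f = (\<Sum>i\<in>UNIV. y $ i * X i p f)) \<and>
     (\<forall>i j. m \<one>\<^bsub>G\<^esub> (X i \<one>\<^bsub>G\<^esub>) (X j \<one>\<^bsub>G\<^esub>) = (if i = j then 1 else 0))"

(* Components of a tangent vector at p in the frame X. Through them tangent vectors at all points
   are identified with elements of the Lie algebra, that is, with vectors in R^3; since X is
   orthonormal, the metric becomes the standard inner product. A vector field along a curve is
   a function from the parameter interval to R^3. *)
definition coords :: "'g metric \<Rightarrow> (3 \<Rightarrow> 'g \<Rightarrow> 'g tvec) \<Rightarrow> 'g \<Rightarrow> 'g tvec \<Rightarrow> real^3" where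
  "coords m X p w = (\<chi> k. m p w (X k p))"

definition bracket ::
  "('g::topological_space) monoid \<Rightarrow> ('g, real^3) chart set \<Rightarrow> 'g metric \<Rightarrow> (3 \<Rightarrow> 'g \<Rightarrow> 'g tvec) \<Rightarrow>
   real^3 \<Rightarrow> real^3 \<Rightarrow> real^3" where
  "bracket G A m X u v = (\<Sum>i\<in>UNIV. \<Sum>j\<in>UNIV.
     (u $ i * v $ j) *\<^sub>R coords m X \<one>\<^bsub>G\<^esub> (lie_bracket A (X i) (X j) \<one>\<^bsub>G\<^esub>))"

(* For T the velocity of c, this is the covariant derivative along c of the field
   sum_j U_j X_j by the Leibniz rule:
   sum_j U_j' X_j + sum_ij T_i U_j nabla_{X_i} X_j. *)
definition covariant_derivative ::
  "'g metric \<Rightarrow> 'g connection \<Rightarrow> (3 \<Rightarrow> 'g \<Rightarrow> 'g tvec) \<Rightarrow> real set \<Rightarrow> (real \<Rightarrow> 'g) \<Rightarrow>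
   (real \<Rightarrow> real^3) \<Rightarrow> (real \<Rightarrow> real^3) \<Rightarrow> real \<Rightarrow> real^3" where
  "covariant_derivative m nabla X I c T U t =
     vector_derivative U (at t within I) +
     (\<Sum>i\<in>UNIV. \<Sum>j\<in>UNIV. (T t $ i * U t $ j) *\<^sub>R coords m X (c t) (nabla (X i) (X j) (c t)))"


section \<open>Frenet curves\<close>

definition unit_speed_curve ::
  "('g::topological_space, real^3) chart set \<Rightarrow> 'g metric \<Rightarrow> real set \<Rightarrow> (real \<Rightarrow> 'g) \<Rightarrow> bool" where
  "unit_speed_curve A m I c \<longleftrightarrow> smooth_curve A I c \<and>
     (\<forall>t\<in>I. m (c t) (velocity A I c t) (velocity A I c t) = 1)"

definition frenet_apparatus ::
  "('g::topological_space, real^3) chart set \<Rightarrow> 'g metric \<Rightarrow> 'g connection \<Rightarrow> (3 \<Rightarrow> 'g \<Rightarrow> 'g tvec) \<Rightarrow>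
   real set \<Rightarrow> (real \<Rightarrow> 'g) \<Rightarrow> (real \<Rightarrow> real^3) \<Rightarrow> (real \<Rightarrow> real^3) \<Rightarrow> (real \<Rightarrow> real^3) \<Rightarrow>
   (real \<Rightarrow> real) \<Rightarrow> (real \<Rightarrow> real) \<Rightarrow> bool" where
  "frenet_apparatus A m nabla X I c T N B \<kappa> \<tau> \<longleftrightarrow>
     unit_speed_curve A m I c \<and>
     smooth_on I T \<and> smooth_on I N \<and> smooth_on I B \<and>
     (\<forall>t\<in>I. T t = coords m X (c t) (velocity A I c t) \<and>
        \<kappa> t = norm (covariant_derivative m nabla X I c T T t) \<and> \<kappa> t > 0 \<and>
        norm (T t) = 1 \<and> norm (N t) = 1 \<and> norm (B t) = 1 \<and>
        T t \<bullet> N t = 0 \<and> T t \<bullet> B t = 0 \<and> N t \<bullet> B t = 0 \<and>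
        det (vector [T t, N t, B t] :: real^3^3) > 0 \<and>
        covariant_derivative m nabla X I c T T t = \<kappa> t *\<^sub>R N t \<and>
        covariant_derivative m nabla X I c T N t = - \<kappa> t *\<^sub>R T t + \<tau> t *\<^sub>R B t \<and>
        covariant_derivative m nabla X I c T B t = - \<tau> t *\<^sub>R N t)"

definition frenet_curve ::
  "('g::topological_space, real^3) chart set \<Rightarrow> 'g metric \<Rightarrow> 'g connection \<Rightarrow> (3 \<Rightarrow> 'g \<Rightarrow> 'g tvec) \<Rightarrow>
   real set \<Rightarrow> (real \<Rightarrow> 'g) \<Rightarrow> (real \<Rightarrow> real^3) \<Rightarrow> (real \<Rightarrow> real^3) \<Rightarrow> (real \<Rightarrow> real^3) \<Rightarrow>
   (real \<Rightarrow> real) \<Rightarrow> (real \<Rightarrow> real) \<Rightarrow> bool" where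
  "frenet_curve A m nabla X I c T N B \<kappa> \<tau> \<longleftrightarrow>
     frenet_apparatus A m nabla X I c T N B \<kappa> \<tau> \<and> (\<forall>t\<in>I. \<tau> t \<noteq> 0)"

definition lie_torsion ::
  "('g::topological_space) monoid \<Rightarrow> ('g, real^3) chart set \<Rightarrow> 'g metric \<Rightarrow> (3 \<Rightarrow> 'g \<Rightarrow> 'g tvec) \<Rightarrow>
   (real \<Rightarrow> real^3) \<Rightarrow> (real \<Rightarrow> real^3) \<Rightarrow> (real \<Rightarrow> real^3) \<Rightarrow> real \<Rightarrow> real" where
  "lie_torsion G A m X T N B t = 1/2 * (bracket G A m X (T t) (N t) \<bullet> B t)"

definition harmonic_curvature ::
  "('g::topological_space) monoid \<Rightarrow> ('g, real^3) chart set \<Rightarrow> 'g metric \<Rightarrow> (3 \<Rightarrow> 'g \<Rightarrow> 'g tvec) \<Rightarrow>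
   (real \<Rightarrow> real^3) \<Rightarrow> (real \<Rightarrow> real^3) \<Rightarrow> (real \<Rightarrow> real^3) \<Rightarrow>
   (real \<Rightarrow> real) \<Rightarrow> (real \<Rightarrow> real) \<Rightarrow> real \<Rightarrow> real" where
  "harmonic_curvature G A m X T N B \<kappa> \<tau> t = (\<tau> t - lie_torsion G A m X T N B t) / \<kappa> t"

(* The property of a curve on I with the given Frenet-Serret apparatus. *)
definition general_helix ::
  "('g::topological_space) monoid \<Rightarrow> ('g, real^3) chart set \<Rightarrow> 'g metric \<Rightarrow> (3 \<Rightarrow> 'g \<Rightarrow> 'g tvec) \<Rightarrow>
   real set \<Rightarrow> (real \<Rightarrow> real^3) \<Rightarrow> (real \<Rightarrow> real^3) \<Rightarrow> (real \<Rightarrow> real^3) \<Rightarrow>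
   (real \<Rightarrow> real) \<Rightarrow> (real \<Rightarrow> real) \<Rightarrow> bool" where
  "general_helix G A m X I T N B \<kappa> \<tau> \<longleftrightarrow> harmonic_curvature G A m X T N B \<kappa> \<tau> constant_on I"

(* beta, with apparatus T', N', B', kappa', tau', is the natural mate of a curve on I whose
   principal normal is N; the equality T' = N compares Lie-algebra-valued maps. *)
definition natural_mate ::
  "('g::topological_space, real^3) chart set \<Rightarrow> 'g metric \<Rightarrow> 'g connection \<Rightarrow> (3 \<Rightarrow> 'g \<Rightarrow> 'g tvec) \<Rightarrow>
   real set \<Rightarrow> (real \<Rightarrow> real^3) \<Rightarrow> (real \<Rightarrow> 'g) \<Rightarrow>
   (real \<Rightarrow> real^3) \<Rightarrow> (real \<Rightarrow> real^3) \<Rightarrow> (real \<Rightarrow> real^3) \<Rightarrow>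
   (real \<Rightarrow> real) \<Rightarrow> (real \<Rightarrow> real) \<Rightarrow> bool" where
  "natural_mate A m nabla X I N \<beta> T' N' B' \<kappa>' \<tau>' \<longleftrightarrow>
     frenet_apparatus A m nabla X I \<beta> T' N' B' \<kappa>' \<tau>' \<and> (\<forall>t\<in>I. T' t = N t)"

end

theory Submission
  imports Defs
begin

text \<open>Two facts about the Lie group reduce the theorem to a computation with curves in
  three-dimensional space. In left-invariant orthonormal coordinates the bracket is
  \<open>[u, v] = c (u \<times> v)\<close> for one constant \<open>c\<close> (\<open>bracket_cross\<close>), and the covariant derivative along a
  curve with tangent \<open>T\<close> is \<open>U' + (c / 2) (T \<times> U)\<close> (\<open>covariant_derivative_cross\<close>). Hence the Lie group
  torsion of every Frenet frame is \<open>c / 2\<close>.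

  Both facts follow once the coefficients \<open>\<langle>\<nabla>\<^bsub>X i\<^esub> X j, X k\<rangle>\<close> of the connection are alternating in
  \<open>i, j, k\<close>. They are antisymmetric in \<open>j, k\<close> since the metric is left-invariant. They are
  antisymmetric in \<open>i, k\<close> since it is also right-invariant, which makes the left-invariant field
  \<open>X j\<close> a Killing field (\<open>christoffel_skew_outer\<close>). In place of flows, the proof uses the orthonormal
  frame of right-invariant fields that inversion makes out of \<open>X\<close>: its inner products are constant
  and it commutes with left-invariant fields (\<open>left_right_invariant_commute\<close>), which is the symmetry
  of second derivatives of \<open>f (x \<otimes> y)\<close>.

  For the curves, let \<open>\<sigma> = \<tau> - c / 2\<close> and \<open>\<sigma>' = \<tau>' - c / 2\<close>, where \<open>T', N', B'\<close> is the frame of the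
  mate. Differentiating \<open>T' = N\<close> gives \<open>\<kappa>' N' = - \<kappa> T + \<sigma> B\<close>, so the harmonic curvature \<open>\<sigma> / \<kappa>\<close> of
  \<open>\<gamma>\<close> is \<open>- \<langle>N', B\<rangle> / \<langle>N', T\<rangle>\<close>. The derivative of this quotient is \<open>\<sigma>' / \<langle>N', T\<rangle>\<^sup>2\<close>
  (\<open>frenet_mate_slope_derivative\<close>), so it is constant on the interval if and only if \<open>\<sigma>'\<close> vanishes
  there.\<close>

section \<open>Smooth maps on open sets\<close>

text \<open>On an open set derivatives within the set are plain derivatives, and these are unique. So any
  family of derivatives may be exhibited in place of \<open>frechet_derivative\<close>, which makes the
  inductions on the order of differentiability below go through.\<close>

lemma Ck_on_Suc_open:
  assumes "open S"
  shows "Ck_on (Suc k) S f \<longleftrightarrow>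
    (\<exists>f'. (\<forall>x\<in>S. (f has_derivative f' x) (at x)) \<and> (\<forall>v. Ck_on k S (\<lambda>x. f' x v)))"
    (is "?L \<longleftrightarrow> ?R")
proof -
  have cong: "Ck_on j S g" if "Ck_on j S f" "\<And>x. x \<in> S \<Longrightarrow> f x = g x"
    for j and f g :: "'a \<Rightarrow> 'b"
    using that
  proof (induction j arbitrary: f g)
    case 0
    then show ?case using continuous_on_cong by (metis Ck_on.simps(1))
  next
    case (Suc j)
    have d: "(f has_derivative f') (at x within S) \<longleftrightarrow> (g has_derivative f') (at x within S)"
      if "x \<in> S" for x f'
      using has_derivative_transform[OF that, of g f] has_derivative_transform[OF that, of f g]
        Suc.prems(2) by metis
    have "frechet_derivative f (at x within S) = frechet_derivative g (at x within S)"
      if "x \<in> S" for x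
      using d[OF that] by (simp add: frechet_derivative_def)
    moreover have "g differentiable_on S"
      using Suc.prems(1) d by (simp add: differentiable_on_def differentiable_def)
    ultimately show ?case
      using Suc.prems(1) Suc.IH[of "\<lambda>x. frechet_derivative f (at x within S) v"
          "\<lambda>x. frechet_derivative g (at x within S) v" for v] by simp
  qed
  show ?thesis
  proof
    assume ?L
    then have "\<forall>x\<in>S. (f has_derivative frechet_derivative f (at x within S)) (at x)"
      using assms by (metis Ck_on.simps(2) at_within_open differentiable_on_def frechet_derivative_works)
    with \<open>?L\<close> show ?R by (intro exI[of _ "\<lambda>x. frechet_derivative f (at x within S)"]) simp
  next
    assume ?R
    then obtain f' where f': "\<And>x. x \<in> S \<Longrightarrow> (f has_derivative f' x) (at x)"
      and C: "\<And>v. Ck_on k S (\<lambda>x. f' x v)" by blast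
    have "frechet_derivative f (at x within S) = f' x" if "x \<in> S" for x
      using f' that assms by (metis at_within_open frechet_derivative_at)
    moreover have "f differentiable_on S"
      using f' by (auto simp: differentiable_on_def differentiable_def intro: has_derivative_at_withinI)
    ultimately show ?L
      by (auto intro: cong[OF C])
  qed
qed

lemma Ck_on_subset:
  assumes "open S" "open T" "T \<subseteq> S" "Ck_on k S f"
  shows "Ck_on k T f"
  using assms(4)
proof (induction k arbitrary: f)
  case 0
  then show ?case using assms(3) continuous_on_subset by auto
next
  case (Suc k)
  then show ?case
    unfolding Ck_on_Suc_open[OF assms(1)] Ck_on_Suc_open[OF assms(2)] using assms(3) by blast
qed

lemma Ck_on_cong:
  assumes "open S" "Ck_on k S f" "\<And>x. x \<in> S \<Longrightarrow> f x = g x"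
  shows "Ck_on k S g"
proof (cases k)
  case 0
  then show ?thesis using assms continuous_on_cong by (metis Ck_on.simps(1))
next
  case (Suc j)
  have "(g has_derivative f') (at x)" if "(f has_derivative f') (at x)" "x \<in> S" for f' x
    using has_derivative_transform_within_open[OF that(1) assms(1) that(2) assms(3)] .
  then show ?thesis
    using assms(2) unfolding Suc Ck_on_Suc_open[OF assms(1)] by blast
qed

lemma Ck_on_SucD: "open S \<Longrightarrow> Ck_on (Suc k) S f \<Longrightarrow> Ck_on k S f"
proof (induction k arbitrary: f)
  case 0
  then show ?case
    by (simp add: differentiable_imp_continuous_on)
next
  case (Suc k)
  obtain f' where f': "\<forall>x\<in>S. (f has_derivative f' x) (at x)" "\<And>v. Ck_on (Suc k) S (\<lambda>x. f' x v)"
    using Suc.prems(2)[unfolded Ck_on_Suc_open[OF Suc.prems(1), of "Suc k"]] by blast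
  have "\<forall>v. Ck_on k S (\<lambda>x. f' x v)"
    using Suc.IH[OF Suc.prems(1) f'(2)] by blast
  with f'(1) show ?case unfolding Ck_on_Suc_open[OF Suc.prems(1), of k] by blast
qed

lemma Ck_on_const: "open S \<Longrightarrow> Ck_on k S (\<lambda>x. c)"
proof (induction k arbitrary: c)
  case (Suc k)
  then show ?case
    unfolding Ck_on_Suc_open[OF Suc.prems] by (intro exI[of _ "\<lambda>_ _. 0"]) auto
qed auto

lemma Ck_on_add: "open S \<Longrightarrow> Ck_on k S f \<Longrightarrow> Ck_on k S g \<Longrightarrow> Ck_on k S (\<lambda>x. f x + g x)"
proof (induction k arbitrary: f g)
  case 0
  then show ?case by (simp add: continuous_on_add)
next
  case (Suc k)
  obtain f' where f': "\<forall>x\<in>S. (f has_derivative f' x) (at x)" "\<And>v. Ck_on k S (\<lambda>x. f' x v)"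
    using Suc.prems(2) unfolding Ck_on_Suc_open[OF Suc.prems(1)] by blast
  obtain g' where g': "\<forall>x\<in>S. (g has_derivative g' x) (at x)" "\<And>v. Ck_on k S (\<lambda>x. g' x v)"
    using Suc.prems(3) unfolding Ck_on_Suc_open[OF Suc.prems(1)] by blast
  show ?case unfolding Ck_on_Suc_open[OF Suc.prems(1)]
    using f'(1) g'(1) Suc.IH[OF Suc.prems(1) f'(2) g'(2)]
    by (intro exI[of _ "\<lambda>x v. f' x v + g' x v"]) (auto intro!: has_derivative_add)
qed

lemma Ck_on_sum:
  assumes "open S" "finite F" "\<And>b. b \<in> F \<Longrightarrow> Ck_on k S (f b)"
  shows "Ck_on k S (\<lambda>x. \<Sum>b\<in>F. f b x)"
  using assms(2,3) by (induction F) (simp_all add: Ck_on_const Ck_on_add assms(1))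

lemma Ck_on_bounded_linear:
  assumes "open S" "bounded_linear L"
  shows "Ck_on k S f \<Longrightarrow> Ck_on k S (\<lambda>x. L (f x))"
proof (induction k arbitrary: f)
  case 0
  then show ?case using assms(2) by (simp add: bounded_linear.continuous_on)
next
  case (Suc k)
  then obtain f' where f': "\<forall>x\<in>S. (f has_derivative f' x) (at x)" "\<forall>v. Ck_on k S (\<lambda>x. f' x v)"
    unfolding Ck_on_Suc_open[OF assms(1)] by blast
  show ?case unfolding Ck_on_Suc_open[OF assms(1)]
    using f' Suc.IH
    by (intro exI[of _ "\<lambda>x v. L (f' x v)"]) (auto intro: bounded_linear.has_derivative[OF assms(2)])
qed

lemma Ck_on_scaleR:
  fixes a :: "'a::real_normed_vector \<Rightarrow> real"
  assumes "open S"
  shows "Ck_on k S a \<Longrightarrow> Ck_on k S f \<Longrightarrow> Ck_on k S (\<lambda>x. a x *\<^sub>R f x)"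
proof (induction k arbitrary: a f)
  case 0
  then show ?case by (simp add: continuous_on_scaleR)
next
  case (Suc k)
  obtain f' where f': "\<forall>x\<in>S. (f has_derivative f' x) (at x)" "\<forall>v. Ck_on k S (\<lambda>x. f' x v)"
    using Suc.prems(2) unfolding Ck_on_Suc_open[OF assms(1)] by blast
  obtain a' where a': "\<forall>x\<in>S. (a has_derivative a' x) (at x)" "\<forall>v. Ck_on k S (\<lambda>x. a' x v)"
    using Suc.prems(1) unfolding Ck_on_Suc_open[OF assms(1)] by blast
  show ?case unfolding Ck_on_Suc_open[OF assms(1)]
  proof (intro exI[of _ "\<lambda>x v. a x *\<^sub>R f' x v + a' x v *\<^sub>R f x"] conjI ballI allI)
    show "((\<lambda>x. a x *\<^sub>R f x) has_derivative (\<lambda>v. a x *\<^sub>R f' x v + a' x v *\<^sub>R f x)) (at x)"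
      if "x \<in> S" for x
      using that f'(1) a'(1) by (blast intro: has_derivative_scaleR)
    show "Ck_on k S (\<lambda>x. a x *\<^sub>R f' x v + a' x v *\<^sub>R f x)" for v
      by (rule Ck_on_add[OF assms Suc.IH[OF Ck_on_SucD[OF assms Suc.prems(1)] f'(2)[rule_format]]
            Suc.IH[OF a'(2)[rule_format] Ck_on_SucD[OF assms Suc.prems(2)]]])
  qed
qed

text \<open>The derivative of a composition in a fixed direction involves the outer derivative in a
  moving direction; expanding the latter in a basis turns it into a sum of products to which the
  induction hypothesis applies.\<close>

lemma Ck_on_compose:
  fixes f :: "'a::real_normed_vector \<Rightarrow> 'b::euclidean_space"
  assumes "open S" "open T" "f ` S \<subseteq> T"
  shows "Ck_on k S f \<Longrightarrow> Ck_on k T g \<Longrightarrow> Ck_on k S (\<lambda>x. g (f x))"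
proof (induction k arbitrary: g)
  case 0
  then show ?case using assms(3) continuous_on_compose2 by (metis Ck_on.simps(1))
next
  case (Suc k)
  obtain f' where f': "\<And>x. x \<in> S \<Longrightarrow> (f has_derivative f' x) (at x)" "\<And>v. Ck_on k S (\<lambda>x. f' x v)"
    using Suc.prems(1) unfolding Ck_on_Suc_open[OF assms(1)] by blast
  obtain g' where g': "\<And>x. x \<in> T \<Longrightarrow> (g has_derivative g' x) (at x)" "\<And>v. Ck_on k T (\<lambda>x. g' x v)"
    using Suc.prems(2) unfolding Ck_on_Suc_open[OF assms(2)] by blast
  have der: "((\<lambda>x. g (f x)) has_derivative (\<lambda>v. \<Sum>b\<in>Basis. (f' x v \<bullet> b) *\<^sub>R g' (f x) b)) (at x)"
    if "x \<in> S" for x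
  proof -
    have fx: "f x \<in> T" using assms(3) that by auto
    have "((\<lambda>x. g (f x)) has_derivative (\<lambda>v. g' (f x) (f' x v))) (at x)"
      using has_derivative_compose[OF f'(1)[OF that] g'(1)[OF fx]] .
    moreover have "g' (f x) w = (\<Sum>b\<in>Basis. (w \<bullet> b) *\<^sub>R g' (f x) b)" for w
    proof -
      have l: "linear (g' (f x))" using g'(1)[OF fx] has_derivative_linear by blast
      have "g' (f x) (\<Sum>b\<in>Basis. (w \<bullet> b) *\<^sub>R b) = (\<Sum>b\<in>Basis. (w \<bullet> b) *\<^sub>R g' (f x) b)"
        by (simp add: linear_sum[OF l] linear_cmul[OF l])
      then show ?thesis by (simp add: euclidean_representation)
    qed
    then have "(\<lambda>v. g' (f x) (f' x v)) = (\<lambda>v. \<Sum>b\<in>Basis. (f' x v \<bullet> b) *\<^sub>R g' (f x) b)"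
      by (rule ext)
    ultimately show ?thesis by (rule back_subst[where P="\<lambda>D. (_ has_derivative D) (at x)"])
  qed
  have "Ck_on k S (\<lambda>x. \<Sum>b\<in>Basis. (f' x v \<bullet> b) *\<^sub>R g' (f x) b)" for v
  proof (rule Ck_on_sum[OF assms(1) finite_Basis])
    fix b :: 'b assume "b \<in> Basis"
    show "Ck_on k S (\<lambda>x. (f' x v \<bullet> b) *\<^sub>R g' (f x) b)"
    proof (rule Ck_on_scaleR[OF assms(1)])
      show "Ck_on k S (\<lambda>x. f' x v \<bullet> b)"
        by (rule Ck_on_bounded_linear[OF assms(1) bounded_linear_inner_left f'(2)])
      show "Ck_on k S (\<lambda>x. g' (f x) b)"
        by (rule Suc.IH[OF Ck_on_SucD[OF assms(1) Suc.prems(1)] g'(2)])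
    qed
  qed
  with der show ?case unfolding Ck_on_Suc_open[OF assms(1)]
    by (intro exI[of _ "\<lambda>x v. \<Sum>b\<in>Basis. (f' x v \<bullet> b) *\<^sub>R g' (f x) b"]) simp
qed

lemma smooth_on_subset: "open S \<Longrightarrow> open T \<Longrightarrow> T \<subseteq> S \<Longrightarrow> smooth_on S f \<Longrightarrow> smooth_on T f"
  by (simp add: smooth_on_def Ck_on_subset[of S T])

lemma smooth_on_cong:
  assumes "open S" "smooth_on S f" "\<And>x. x \<in> S \<Longrightarrow> f x = g x"
  shows "smooth_on S g"
  using assms(2) Ck_on_cong[OF assms(1) _ assms(3)] by (auto simp: smooth_on_def)

lemma smooth_on_compose:
  fixes f :: "'a::real_normed_vector \<Rightarrow> 'b::euclidean_space"
  assumes "open S" "open T" "f ` S \<subseteq> T" "smooth_on S f" "smooth_on T g"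
  shows "smooth_on S (\<lambda>x. g (f x))"
  using assms(4,5) by (auto simp: smooth_on_def intro: Ck_on_compose[OF assms(1-3)])

lemma smooth_on_add:
  assumes "open S" "smooth_on S f" "smooth_on S g"
  shows "smooth_on S (\<lambda>x. f x + g x)"
  using assms(2,3) by (auto simp: smooth_on_def intro: Ck_on_add[OF assms(1)])

lemma smooth_on_mult:
  fixes f g :: "'a::real_normed_vector \<Rightarrow> real"
  assumes "open S" "smooth_on S f" "smooth_on S g"
  shows "smooth_on S (\<lambda>x. f x * g x)"
  using assms(2,3) Ck_on_scaleR[OF assms(1), of _ f g] by (simp add: smooth_on_def)

lemma smooth_on_const: "open S \<Longrightarrow> smooth_on S (\<lambda>x. c)"
  by (simp add: smooth_on_def Ck_on_const)

lemma smooth_on_affine: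
  assumes "open S" "bounded_linear L"
  shows "smooth_on S (\<lambda>x. c + L x)"
proof -
  have "Ck_on k S (\<lambda>x. c + L x)" for k
  proof (cases k)
    case 0
    then show ?thesis
      using bounded_linear.continuous_on[OF assms(2) continuous_on_id, of S]
      by (simp add: continuous_on_add)
  next
    case (Suc j)
    have "((\<lambda>x. c + L x) has_derivative L) (at x)" for x
      using has_derivative_add[OF has_derivative_const bounded_linear_imp_has_derivative[OF assms(2)]]
      by simp
    then show ?thesis
      unfolding Suc Ck_on_Suc_open[OF assms(1)]
      by (intro exI[of _ "\<lambda>_. L"]) (simp add: Ck_on_const[OF assms(1)])
  qed
  then show ?thesis by (simp add: smooth_on_def)
qed

lemma smooth_on_frechet_derivative:
  assumes "open S" "smooth_on S f"
  shows smooth_on_has_derivative: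
      "x \<in> S \<Longrightarrow> (f has_derivative frechet_derivative f (at x)) (at x)"
    and "smooth_on S (\<lambda>x. frechet_derivative f (at x) v)"
proof -
  have C: "Ck_on (Suc k) S f" for k using assms(2) by (simp only: smooth_on_def)
  show d: "(f has_derivative frechet_derivative f (at x)) (at x)" if "x \<in> S" for x
    using C[of 0] that assms(1)
    by (metis Ck_on.simps(2) at_within_open differentiable_on_def frechet_derivative_works)
  have "Ck_on k S (\<lambda>x. frechet_derivative f (at x) v)" for k
  proof (rule Ck_on_cong[OF assms(1)])
    show "Ck_on k S (\<lambda>x. frechet_derivative f (at x within S) v)" using C[of k] by simp
  qed (simp add: at_within_open[OF _ assms(1)])
  then show "smooth_on S (\<lambda>x. frechet_derivative f (at x) v)" by (simp add: smooth_on_def)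
qed

section \<open>Symmetry of second derivatives\<close>

text \<open>Both mixed derivatives are limits of the same second difference quotient: two applications
  of the mean value theorem to
  \<open>f (x + h u + h v) - f (x + h u) - f (x + h v) + f x\<close>, in either order, produce values of the two
  mixed derivatives at points that tend to \<open>x\<close> with \<open>h\<close>.\<close>

lemma second_difference_mean_value:
  fixes f :: "'a::real_normed_vector \<Rightarrow> real"
  assumes f': "\<And>y. y \<in> ball x r \<Longrightarrow> (f has_derivative f' y) (at y)"
    and f'': "\<And>y. y \<in> ball x r \<Longrightarrow> ((\<lambda>y. f' y u) has_derivative f'' y) (at y)"
    and h: "0 < h" "h * (norm u + norm v) < r"
  obtains y where "dist x y \<le> h * (norm u + norm v)"
    "f (x + h *\<^sub>R u + h *\<^sub>R v) - f (x + h *\<^sub>R u) - f (x + h *\<^sub>R v) + f x = h * h * f'' y v"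
proof -
  have dst: "dist x (x + s *\<^sub>R u + t *\<^sub>R v) \<le> h * (norm u + norm v)"
    if "0 \<le> s" "s \<le> h" "0 \<le> t" "t \<le> h" for s t
  proof -
    have "dist x (x + s *\<^sub>R u + t *\<^sub>R v) = norm (s *\<^sub>R u + t *\<^sub>R v)"
      by (metis add.assoc add_diff_cancel_left' dist_commute dist_norm)
    also have "\<dots> \<le> s * norm u + t * norm v"
      using norm_triangle_ineq[of "s *\<^sub>R u" "t *\<^sub>R v"] that by simp
    also have "\<dots> \<le> h * norm u + h * norm v"
      using that by (intro add_mono mult_right_mono) auto
    finally show ?thesis by (simp add: distrib_left)
  qed
  have inb: "x + s *\<^sub>R u + t *\<^sub>R v \<in> ball x r" if "0 \<le> s" "s \<le> h" "0 \<le> t" "t \<le> h" for s t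
    using dst[OF that] h by simp
  define p where "p s = f (x + s *\<^sub>R u + h *\<^sub>R v) - f (x + s *\<^sub>R u)" for s
  have dp: "(p has_real_derivative f' (x + s *\<^sub>R u + h *\<^sub>R v) u - f' (x + s *\<^sub>R u) u) (at s)"
    if s: "0 \<le> s" "s \<le> h" for s
  proof -
    have "((\<lambda>s. x + s *\<^sub>R u + t *\<^sub>R v) has_derivative (\<lambda>s. s *\<^sub>R u)) (at s)" for t
      by (auto intro!: derivative_eq_intros)
    note c = has_derivative_compose[OF this f'[OF inb]]
    have l: "f' y (k *\<^sub>R u) = f' y u * k" if "y \<in> ball x r" for y k
      using linear_cmul[OF has_derivative_linear[OF f'[OF that]]] by simp
    have "((\<lambda>s. f (x + s *\<^sub>R u + t *\<^sub>R v)) has_real_derivative f' (x + s *\<^sub>R u + t *\<^sub>R v) u) (at s)"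
      if "0 \<le> t" "t \<le> h" for t
      using c[OF s that] l[OF inb[OF s that]] by (simp add: has_field_derivative_def)
    note d = this
    show ?thesis
      unfolding p_def using DERIV_diff[OF d[of h] d[of 0]] h(1) by simp
  qed
  obtain s where s: "0 < s" "s < h" "p h - p 0 = (h - 0) * (f' (x + s *\<^sub>R u + h *\<^sub>R v) u - f' (x + s *\<^sub>R u) u)"
    using MVT2[OF h(1) dp] by blast
  have dq: "((\<lambda>t. f' (x + s *\<^sub>R u + t *\<^sub>R v) u) has_real_derivative f'' (x + s *\<^sub>R u + t *\<^sub>R v) v) (at t)"
    if "0 \<le> t" "t \<le> h" for t
  proof -
    have y: "x + s *\<^sub>R u + t *\<^sub>R v \<in> ball x r" using inb that s by simp
    have "((\<lambda>t. x + s *\<^sub>R u + t *\<^sub>R v) has_derivative (\<lambda>t. t *\<^sub>R v)) (at t)"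
      by (auto intro!: derivative_eq_intros)
    from has_derivative_compose[OF this f''[OF y]]
    have "((\<lambda>t. f' (x + s *\<^sub>R u + t *\<^sub>R v) u) has_derivative
        (\<lambda>k. k * f'' (x + s *\<^sub>R u + t *\<^sub>R v) v)) (at t)"
      using linear_cmul[OF has_derivative_linear[OF f''[OF y]]] by simp
    then show ?thesis by (rule has_derivative_imp_has_field_derivative) simp
  qed
  obtain t where t: "0 < t" "t < h"
    "f' (x + s *\<^sub>R u + h *\<^sub>R v) u - f' (x + s *\<^sub>R u + 0 *\<^sub>R v) u = (h - 0) * f'' (x + s *\<^sub>R u + t *\<^sub>R v) v"
    using MVT2[OF h(1) dq] by blast
  show ?thesis
  proof (rule that)
    show "dist x (x + s *\<^sub>R u + t *\<^sub>R v) \<le> h * (norm u + norm v)"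
      using dst s t by simp
    show "f (x + h *\<^sub>R u + h *\<^sub>R v) - f (x + h *\<^sub>R u) - f (x + h *\<^sub>R v) + f x = h * h * f'' (x + s *\<^sub>R u + t *\<^sub>R v) v"
      using s(3) t(3) by (simp add: p_def)
  qed
qed

lemma symmetric_second_derivative:
  fixes f :: "'a::real_normed_vector \<Rightarrow> real"
  assumes "open S" "x \<in> S" "smooth_on S f"
  shows "frechet_derivative (\<lambda>y. frechet_derivative f (at y) u) (at x) v =
    frechet_derivative (\<lambda>y. frechet_derivative f (at y) v) (at x) u"
proof -
  define D where "D u y = frechet_derivative f (at y) u" for u y
  define H where "H u v y = frechet_derivative (D u) (at y) v" for u v y
  have sm: "smooth_on S (D u)" for u
    unfolding D_def[abs_def] by (rule smooth_on_frechet_derivative[OF assms(1,3)])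
  have cont: "isCont (H u v) x" for u v
  proof -
    have "smooth_on S (H u v)"
      unfolding H_def[abs_def] by (rule smooth_on_frechet_derivative[OF assms(1) sm])
    then have "continuous_on S (H u v)" by (metis Ck_on.simps(1) smooth_on_def)
    then show ?thesis using assms(1,2) continuous_on_eq_continuous_at by blast
  qed
  obtain r where r: "r > 0" "ball x r \<subseteq> S"
    using assms(1,2) open_contains_ball by blast
  have d1: "(f has_derivative (\<lambda>w. D w y)) (at y)" if "y \<in> ball x r" for y
    using smooth_on_has_derivative[OF assms(1,3)] that r(2) unfolding D_def by blast
  have d2: "((\<lambda>y. D w y) has_derivative (\<lambda>z. H w z y)) (at y)" if "y \<in> ball x r" for y w
    using smooth_on_has_derivative[OF assms(1) sm] that r(2) unfolding H_def by blast
  have "dist (H u v x) (H v u x) \<le> e" if "e > 0" for e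
  proof -
    obtain d1' where d1': "d1' > 0" "\<And>y. dist y x < d1' \<Longrightarrow> dist (H u v y) (H u v x) < e / 2"
      using cont[of u v] \<open>e > 0\<close> unfolding continuous_at_eps_delta by (meson half_gt_zero)
    obtain d2' where d2': "d2' > 0" "\<And>y. dist y x < d2' \<Longrightarrow> dist (H v u y) (H v u x) < e / 2"
      using cont[of v u] \<open>e > 0\<close> unfolding continuous_at_eps_delta by (meson half_gt_zero)
    \<comment> \<open>Below this scale the mean value points of both orders stay where the two mixed derivatives
      differ from their values at \<open>x\<close> by less than \<open>e / 2\<close>.\<close>
    define d where "d = min r (min d1' d2')"
    have "d > 0" using r d1' d2' by (simp add: d_def)
    define h where "h = d / (2 * (norm u + norm v + 1))"
    have pos: "norm u + norm v + 1 > 0" by (simp add: add_nonneg_pos)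
    have "h > 0" using \<open>d > 0\<close> pos by (simp add: h_def)
    have "h * (norm u + norm v) \<le> h * (norm u + norm v + 1)" using \<open>h > 0\<close> by simp
    also have "\<dots> = d / 2" using pos unfolding h_def by (simp add: divide_simps)
    finally have hd: "h * (norm u + norm v) < d" using \<open>d > 0\<close> by simp
    have hr: "h * (norm u + norm v) < r" "h * (norm v + norm u) < r"
      using hd by (simp_all add: d_def add.commute)
    obtain y where y: "dist x y \<le> h * (norm u + norm v)"
      "f (x + h *\<^sub>R u + h *\<^sub>R v) - f (x + h *\<^sub>R u) - f (x + h *\<^sub>R v) + f x = h * h * H u v y"
      using second_difference_mean_value[OF d1 d2 \<open>h > 0\<close> hr(1)] by blast
    obtain z where z: "dist x z \<le> h * (norm v + norm u)"
      "f (x + h *\<^sub>R v + h *\<^sub>R u) - f (x + h *\<^sub>R v) - f (x + h *\<^sub>R u) + f x = h * h * H v u z"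
      using second_difference_mean_value[OF d1 d2 \<open>h > 0\<close> hr(2)] by blast
    have "h * h * H u v y = h * h * H v u z"
      using y(2) z(2) by (simp add: algebra_simps)
    then have "H u v y = H v u z" using \<open>h > 0\<close> by simp
    moreover have "dist (H u v y) (H u v x) < e / 2"
      using y(1) hd by (intro d1') (simp add: d_def dist_commute)
    moreover have "dist (H v u z) (H v u x) < e / 2"
      using z(1) hd by (intro d2') (simp add: d_def dist_commute add.commute)
    ultimately show ?thesis by (simp add: dist_real_def abs_if split: if_splits)
  qed
  then have "dist (H u v x) (H v u x) \<le> 0"
    using field_le_epsilon[of "dist (H u v x) (H v u x)" 0] by simp
  then show ?thesis by (simp add: H_def D_def[abs_def])
qed


section \<open>Charts and smooth functions on a manifold\<close>

text \<open>The condition that an atlas imposes on each single chart, isolated so that it can also be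
  established for products of charts.\<close>

definition chart :: "'g::topological_space set \<Rightarrow> ('g \<Rightarrow> 'e::euclidean_space) \<Rightarrow> bool" where
  "chart U \<phi> \<longleftrightarrow> open U \<and> open (\<phi> ` U) \<and> homeomorphism U (\<phi> ` U) \<phi> (inv_into U \<phi>)"

lemma chartD:
  assumes "chart U \<phi>"
  shows "open U" "open (\<phi> ` U)" "continuous_on U \<phi>" "continuous_on (\<phi> ` U) (inv_into U \<phi>)"
    and chart_inv [simp]: "x \<in> U \<Longrightarrow> inv_into U \<phi> (\<phi> x) = x"
  using assms unfolding chart_def homeomorphism_def by blast+

lemma chartI:
  assumes "open U" "open (\<phi> ` U)" "continuous_on U \<phi>" "continuous_on (\<phi> ` U) (inv_into U \<phi>)" "inj_on \<phi> U"
  shows "chart U \<phi>"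
  unfolding chart_def
proof (intro conjI assms homeomorphismI)
  show "inv_into U \<phi> ` \<phi> ` U \<subseteq> U" by (auto intro: inv_into_into)
qed (auto simp: assms(5) f_inv_into_f)

lemma chart_open_image:
  assumes "chart U \<phi>" "open W"
  shows "open (\<phi> ` (U \<inter> W))"
proof -
  have "\<phi> ` (U \<inter> W) = \<phi> ` U \<inter> inv_into U \<phi> -` W" using assms(1) by auto
  then show ?thesis
    using continuous_open_preimage[OF chartD(4,2)[OF assms(1)] assms(2)] by metis
qed

lemma chart_open_preimage: "chart U \<phi> \<Longrightarrow> open S \<Longrightarrow> open (U \<inter> \<phi> -` S)"
  by (rule continuous_open_preimage[OF chartD(3,1)])

lemma chart_prod:
  assumes "chart U \<phi>" "chart V \<psi>"
  shows "chart (U \<times> V) (map_prod \<phi> \<psi>)"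
    and "y \<in> \<phi> ` U \<Longrightarrow> z \<in> \<psi> ` V \<Longrightarrow>
      inv_into (U \<times> V) (map_prod \<phi> \<psi>) (y, z) = (inv_into U \<phi> y, inv_into V \<psi> z)"
proof -
  have inj: "inj_on \<phi> U" "inj_on \<psi> V"
    using assms by (metis chart_inv inj_on_inverseI)+
  then have inj2: "inj_on (map_prod \<phi> \<psi>) (U \<times> V)" by (rule map_prod_inj_on)
  then have inv: "inv_into (U \<times> V) (map_prod \<phi> \<psi>) (y, z) = (inv_into U \<phi> y, inv_into V \<psi> z)"
    if "y \<in> \<phi> ` U" "z \<in> \<psi> ` V" for y z
    using that assms by (intro inv_into_f_eq) (auto simp: inv_into_into f_inv_into_f)
  then show "y \<in> \<phi> ` U \<Longrightarrow> z \<in> \<psi> ` V \<Longrightarrow>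
      inv_into (U \<times> V) (map_prod \<phi> \<psi>) (y, z) = (inv_into U \<phi> y, inv_into V \<psi> z)" .
  have im: "map_prod \<phi> \<psi> ` (U \<times> V) = \<phi> ` U \<times> \<psi> ` V" by (auto simp: map_prod_def image_iff)
  have c: "continuous_on U \<phi>" "continuous_on V \<psi>"
    "continuous_on (\<phi> ` U) (inv_into U \<phi>)" "continuous_on (\<psi> ` V) (inv_into V \<psi>)"
    using assms chartD by blast+
  have m: "continuous_on (S \<times> R) (\<lambda>(x, y). (f x, g y))"
    if "continuous_on S f" "continuous_on R g" for S R and f :: "'x::topological_space \<Rightarrow> 'y::topological_space"
      and g :: "'z::topological_space \<Rightarrow> 'w::topological_space"
    unfolding split_def
    by (intro continuous_on_Pair continuous_on_compose2[OF that(1)] continuous_on_compose2[OF that(2)]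
        continuous_on_fst continuous_on_snd continuous_on_id) auto
  have "continuous_on (U \<times> V) (map_prod \<phi> \<psi>)"
    using m[OF c(1,2)] by (simp add: map_prod_def)
  moreover have "continuous_on (\<phi> ` U \<times> \<psi> ` V) (inv_into (U \<times> V) (map_prod \<phi> \<psi>))"
    using m[OF c(3,4)]
    by (rule continuous_on_eq) (use inv in auto)
  ultimately show "chart (U \<times> V) (map_prod \<phi> \<psi>)"
    using inj2 chartD(1,2)[OF assms(1)] chartD(1,2)[OF assms(2)]
    by (intro chartI) (simp_all add: im open_Times)
qed

lemma atlas_chart: "smooth_atlas A \<Longrightarrow> (U, \<phi>) \<in> A \<Longrightarrow> chart U \<phi>"
  by (auto simp: smooth_atlas_def chart_def)

lemma atlas_cover:
  assumes "smooth_atlas A"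
  obtains U \<phi> where "(U, \<phi>) \<in> A" "chart U \<phi>" "p \<in> U"
proof -
  have "p \<in> (\<Union>(U, \<phi>)\<in>A. U)" using assms by (simp add: smooth_atlas_def)
  then show ?thesis using that atlas_chart[OF assms] by blast
qed

lemma atlas_transition:
  "smooth_atlas A \<Longrightarrow> (U, \<phi>) \<in> A \<Longrightarrow> (V, \<psi>) \<in> A \<Longrightarrow>
    smooth_on (\<phi> ` (U \<inter> V)) (\<psi> \<circ> inv_into U \<phi>)"
  by (auto simp: smooth_atlas_def)

text \<open>Since transition maps are smooth, smoothness near a point may be tested in any one chart.\<close>

lemma smooth_at_chart:
  assumes "smooth_atlas A" "(U, \<phi>) \<in> A" "p \<in> U"
  shows "smooth_at A p f \<longleftrightarrow>
    (\<exists>S. open S \<and> \<phi> p \<in> S \<and> S \<subseteq> \<phi> ` U \<and> smooth_on S (f \<circ> inv_into U \<phi>))"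
proof
  assume "smooth_at A p f"
  then obtain W where "open W" "p \<in> W" "smooth_on (\<phi> ` (U \<inter> W)) (f \<circ> inv_into U \<phi>)"
    using assms(2) by (auto simp: smooth_at_def)
  then show "\<exists>S. open S \<and> \<phi> p \<in> S \<and> S \<subseteq> \<phi> ` U \<and> smooth_on S (f \<circ> inv_into U \<phi>)"
    using assms chart_open_image[OF atlas_chart[OF assms(1,2)]]
    by (intro exI[of _ "\<phi> ` (U \<inter> W)"]) auto
next
  note ch = atlas_chart[OF assms(1,2)]
  assume "\<exists>S. open S \<and> \<phi> p \<in> S \<and> S \<subseteq> \<phi> ` U \<and> smooth_on S (f \<circ> inv_into U \<phi>)"
  then obtain S where S: "open S" "\<phi> p \<in> S" "smooth_on S (f \<circ> inv_into U \<phi>)" by blast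
  define W where "W = U \<inter> \<phi> -` S"
  have W: "open W" unfolding W_def using ch S(1) by (rule chart_open_preimage)
  have "smooth_on (\<psi> ` (V \<inter> W)) (f \<circ> inv_into V \<psi>)" if V: "(V, \<psi>) \<in> A" for V \<psi>
  proof -
    note ch' = atlas_chart[OF assms(1) V]
    have op: "open (\<psi> ` (V \<inter> W))" using chart_open_image[OF ch' W] .
    have t: "smooth_on (\<psi> ` (V \<inter> W)) (\<phi> \<circ> inv_into V \<psi>)"
      by (rule smooth_on_subset[OF chart_open_image[OF ch' chartD(1)[OF ch]] op _
            atlas_transition[OF assms(1) V assms(2)]]) (auto simp: W_def)
    show ?thesis
    proof (rule smooth_on_cong[OF op smooth_on_compose[OF op S(1) _ t S(3)]])
      show "(\<phi> \<circ> inv_into V \<psi>) ` \<psi> ` (V \<inter> W) \<subseteq> S" using ch' by (auto simp: W_def)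
      show "(f \<circ> inv_into U \<phi>) ((\<phi> \<circ> inv_into V \<psi>) x) = (f \<circ> inv_into V \<psi>) x"
        if "x \<in> \<psi> ` (V \<inter> W)" for x
        using that ch ch' by (auto simp: W_def)
    qed
  qed
  then show "smooth_at A p f"
    unfolding smooth_at_def using W S(2) assms(3) by (intro exI[of _ W]) (auto simp: W_def)
qed

lemma smooth_at_combine:
  fixes A :: "('g::{t2_space, second_countable_topology}, 'e::euclidean_space) chart set"
  assumes "smooth_atlas A" "smooth_at A p f" "smooth_at A p g"
    and F: "\<And>(S :: 'e set) f g. open S \<Longrightarrow> smooth_on S f \<Longrightarrow> smooth_on S g \<Longrightarrow> smooth_on S (\<lambda>x. F (f x) (g x))"
  shows "smooth_at A p (\<lambda>q. F (f q) (g q))"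
proof -
  obtain U \<phi> where U: "(U, \<phi>) \<in> A" "chart U \<phi>" "p \<in> U" using atlas_cover[OF assms(1)] .
  note ch = smooth_at_chart[OF assms(1) U(1,3)]
  obtain S where S: "open S" "\<phi> p \<in> S" "S \<subseteq> \<phi> ` U" "smooth_on S (f \<circ> inv_into U \<phi>)"
    using assms(2) ch by blast
  obtain R where R: "open R" "\<phi> p \<in> R" "R \<subseteq> \<phi> ` U" "smooth_on R (g \<circ> inv_into U \<phi>)"
    using assms(3) ch by blast
  have "smooth_on (S \<inter> R) (\<lambda>x. F ((f \<circ> inv_into U \<phi>) x) ((g \<circ> inv_into U \<phi>) x))"
  proof (rule F)
    show op: "open (S \<inter> R)" using S(1) R(1) by blast
    show "smooth_on (S \<inter> R) (f \<circ> inv_into U \<phi>)" by (rule smooth_on_subset[OF S(1) op _ S(4)]) blast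
    show "smooth_on (S \<inter> R) (g \<circ> inv_into U \<phi>)" by (rule smooth_on_subset[OF R(1) op _ R(4)]) blast
  qed
  then show ?thesis unfolding ch using S R
    by (intro exI[of _ "S \<inter> R"]) (auto simp: comp_def)
qed

lemma smooth_at_add:
  "smooth_atlas A \<Longrightarrow> smooth_at A p f \<Longrightarrow> smooth_at A p g \<Longrightarrow> smooth_at A p (\<lambda>q. f q + g q)"
  by (rule smooth_at_combine) (auto intro: smooth_on_add)

lemma smooth_at_mult:
  "smooth_atlas A \<Longrightarrow> smooth_at A p f \<Longrightarrow> smooth_at A p g \<Longrightarrow> smooth_at A p (\<lambda>q. f q * g q)"
  by (rule smooth_at_combine) (auto intro: smooth_on_mult)

lemma smooth_at_const: "smooth_atlas A \<Longrightarrow> smooth_at A p (\<lambda>q. c)"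
  unfolding smooth_at_def using chartD(2)[OF atlas_chart]
  by (intro exI[of _ UNIV]) (auto simp: comp_def intro!: smooth_on_const)

text \<open>The source is described by a single chart, because for multiplication it is a product
  manifold, where only the charts of \<open>prod_atlas\<close> are at hand.\<close>

lemma smooth_map_pullback:
  assumes "smooth_atlas B" "smooth_map A B h" "(U, \<phi>) \<in> A" "chart U \<phi>" "p \<in> U"
    and "smooth_at B (h p) f"
  obtains S where "open S" "\<phi> p \<in> S" "S \<subseteq> \<phi> ` U" "smooth_on S (f \<circ> h \<circ> inv_into U \<phi>)"
proof -
  obtain V \<zeta> where V: "(V, \<zeta>) \<in> B" "chart V \<zeta>" "h p \<in> V" using atlas_cover[OF assms(1)] .
  obtain W where W: "open W" "h p \<in> W" "smooth_on (\<zeta> ` (V \<inter> W)) (f \<circ> inv_into V \<zeta>)"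
    using assms(6) V(1) unfolding smooth_at_def by blast
  have pre: "open (h -` Q)" if "open Q" for Q
    using assms(2) that by (simp add: smooth_map_def open_vimage)
  define S where "S = \<phi> ` (U \<inter> h -` (V \<inter> W))"
  have opV: "open V" by (rule chartD(1)[OF V(2)])
  have op: "open S" unfolding S_def using opV W(1) by (intro chart_open_image[OF assms(4)] pre) auto
  have "smooth_on (\<phi> ` (U \<inter> h -` V)) (\<zeta> \<circ> h \<circ> inv_into U \<phi>)"
    using assms(2,3) V(1) by (auto simp: smooth_map_def)
  then have t: "smooth_on S (\<zeta> \<circ> h \<circ> inv_into U \<phi>)"
    using chart_open_image[OF assms(4) pre[OF opV]] op
    by (rule_tac smooth_on_subset) (auto simp: S_def)
  have "smooth_on S (f \<circ> h \<circ> inv_into U \<phi>)"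
  proof (rule smooth_on_cong[OF op smooth_on_compose[OF op chart_open_image[OF V(2) W(1)] _ t W(3)]])
    show "(\<zeta> \<circ> h \<circ> inv_into U \<phi>) ` S \<subseteq> \<zeta> ` (V \<inter> W)" using assms(4) by (auto simp: S_def)
    show "(f \<circ> inv_into V \<zeta>) ((\<zeta> \<circ> h \<circ> inv_into U \<phi>) x) = (f \<circ> h \<circ> inv_into U \<phi>) x"
      if "x \<in> S" for x
      using that assms(4) V(2) by (auto simp: S_def)
  qed
  then show ?thesis using that op assms(5) V(3) W(2) by (auto simp: S_def)
qed

lemma smooth_at_pullback:
  assumes "smooth_atlas A" "smooth_atlas B" "smooth_map A B h" "smooth_at B (h p) f"
  shows "smooth_at A p (f \<circ> h)"
proof -
  obtain U \<phi> where U: "(U, \<phi>) \<in> A" "chart U \<phi>" "p \<in> U" using atlas_cover[OF assms(1)] .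
  show ?thesis
    unfolding smooth_at_chart[OF assms(1) U(1,3)]
    using smooth_map_pullback[OF assms(2,3) U assms(4)] by metis
qed

section \<open>Tangent vectors in a chart\<close>

text \<open>The tangent vector at \<open>p\<close> whose coordinates in the chart \<open>\<phi>\<close> are \<open>w\<close>.\<close>

definition chart_vector ::
  "('g::topological_space, 'e::euclidean_space) chart set \<Rightarrow> 'g set \<Rightarrow> ('g \<Rightarrow> 'e) \<Rightarrow> 'g \<Rightarrow> 'e \<Rightarrow> 'g tvec" where
  "chart_vector A U \<phi> p w =
    (\<lambda>f. if smooth_at A p f then frechet_derivative (f \<circ> inv_into U \<phi>) (at (\<phi> p)) w else 0)"

lemma smooth_at_chart_derivative:
  assumes "smooth_atlas A" "(U, \<phi>) \<in> A" "p \<in> U" "smooth_at A p f"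
  shows "((f \<circ> inv_into U \<phi>) has_derivative frechet_derivative (f \<circ> inv_into U \<phi>) (at (\<phi> p))) (at (\<phi> p))"
  using assms(4) smooth_on_has_derivative unfolding smooth_at_chart[OF assms(1-3)] by blast

lemma velocity_chart:
  assumes "smooth_atlas A" "(U, \<phi>) \<in> A" "c t \<in> U" "open I" "t \<in> I" "smooth_curve A I c"
  shows "velocity A I c t = chart_vector A U \<phi> (c t) (frechet_derivative (\<phi> \<circ> c) (at t) 1)"
proof
  fix f
  define J where "J = I \<inter> c -` U"
  have ch: "chart U \<phi>" using atlas_chart assms by blast
  have J: "open J" "t \<in> J"
    using assms(3-6) continuous_open_preimage[OF _ assms(4) chartD(1)[OF ch]]
    by (auto simp: J_def smooth_curve_def)
  have "smooth_on J (\<phi> \<circ> c)" using assms by (auto simp: J_def smooth_curve_def)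
  then have d1: "((\<phi> \<circ> c) has_derivative frechet_derivative (\<phi> \<circ> c) (at t)) (at t)"
    using smooth_on_has_derivative J by blast
  show "velocity A I c t f = chart_vector A U \<phi> (c t) (frechet_derivative (\<phi> \<circ> c) (at t) 1) f"
  proof (cases "smooth_at A (c t) f")
    case True
    let ?D = "frechet_derivative (f \<circ> inv_into U \<phi>) (at (\<phi> (c t)))"
    note d2 = smooth_at_chart_derivative[OF assms(1-3) True]
    have "(((f \<circ> inv_into U \<phi>) \<circ> (\<phi> \<circ> c)) has_derivative (?D \<circ> frechet_derivative (\<phi> \<circ> c) (at t))) (at t)"
      using d1 d2 by (intro diff_chain_at) auto
    then have "((f \<circ> c) has_derivative (?D \<circ> frechet_derivative (\<phi> \<circ> c) (at t))) (at t)"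
      by (rule has_derivative_transform_within_open[OF _ J]) (use ch in \<open>auto simp: J_def\<close>)
    also have "(?D \<circ> frechet_derivative (\<phi> \<circ> c) (at t)) =
        (\<lambda>r. r *\<^sub>R ?D (frechet_derivative (\<phi> \<circ> c) (at t) 1))"
    proof
      fix r
      show "(?D \<circ> frechet_derivative (\<phi> \<circ> c) (at t)) r =
        r *\<^sub>R ?D (frechet_derivative (\<phi> \<circ> c) (at t) 1)"
      using linear_cmul[OF has_derivative_linear[OF d1], of r 1] linear_cmul[OF has_derivative_linear[OF d2]]
        by simp
    qed
    finally have "((f \<circ> c) has_vector_derivative ?D (frechet_derivative (\<phi> \<circ> c) (at t) 1)) (at t)"
      unfolding has_vector_derivative_def .
    then show ?thesis using True at_within_open[OF assms(5,4)]
      by (simp add: velocity_def chart_vector_def vector_derivative_at)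
  qed (simp add: velocity_def chart_vector_def)
qed

text \<open>By the chain rule a curve acts on functions only through the velocity of its coordinates, and
  every \<open>w\<close> is the velocity of a coordinate line. This exhibits the set of velocities of curves as
  a linear image of the model space.\<close>

lemma tangent_space_chart:
  assumes "smooth_atlas A" "(U, \<phi>) \<in> A" "p \<in> U"
  shows "tangent_space A p = range (chart_vector A U \<phi> p)"
proof (intro equalityI subsetI)
  fix u assume "u \<in> tangent_space A p"
  then obtain e c where "u = velocity A {-e<..<e} c 0" "e > 0" "smooth_curve A {-e<..<e} c" "c 0 = p"
    by (auto simp: tangent_space_def)
  then show "u \<in> range (chart_vector A U \<phi> p)"
    using velocity_chart[OF assms(1,2), of c 0 "{-e<..<e}"] assms(3) by auto
next
  note ch = atlas_chart[OF assms(1,2)]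
  fix u assume "u \<in> range (chart_vector A U \<phi> p)"
  then obtain w where w: "u = chart_vector A U \<phi> p w" by blast
  let ?l = "\<lambda>t::real. \<phi> p + t *\<^sub>R w"
  have opU: "open (\<phi> ` U)" by (rule chartD(2)[OF ch])
  have "open (?l -` (\<phi> ` U))"
    by (rule open_vimage[OF opU]) (intro continuous_intros)
  moreover have "0 \<in> ?l -` (\<phi> ` U)" using assms(3) by simp
  ultimately obtain e where e: "e > 0" "ball 0 e \<subseteq> ?l -` (\<phi> ` U)"
    unfolding open_contains_ball by blast
  define I where "I = {-e<..<e}"
  have l: "?l t \<in> \<phi> ` U" if "t \<in> I" for t
    using subsetD[OF e(2), of t] that by (simp add: I_def dist_real_def abs_less_iff)
  define c where "c t = inv_into U \<phi> (?l t)" for t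
  have cU: "c t \<in> U" "\<phi> (c t) = ?l t" if "t \<in> I" for t
    using l[OF that] by (auto simp: c_def inv_into_into f_inv_into_f)
  have "continuous_on I c"
    unfolding c_def[abs_def] using l
    by (intro continuous_on_compose2[OF chartD(4)[OF ch]] continuous_intros) auto
  moreover have "smooth_on (I \<inter> c -` V) (\<psi> \<circ> c)" if V: "(V, \<psi>) \<in> A" for V \<psi>
  proof -
    have opV: "open V" by (rule chartD(1)[OF atlas_chart[OF assms(1) V]])
    have op: "open (I \<inter> c -` V)"
      using \<open>continuous_on I c\<close> opV by (intro continuous_open_preimage) (auto simp: I_def)
    have "smooth_on (I \<inter> c -` V) (\<lambda>t. (\<psi> \<circ> inv_into U \<phi>) (?l t))"
    proof (rule smooth_on_compose[OF op chart_open_image[OF ch opV], where f = ?l])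
      show "?l ` (I \<inter> c -` V) \<subseteq> \<phi> ` (U \<inter> V)" 
      proof (rule image_subsetI)
        fix t assume "t \<in> I \<inter> c -` V"
        then show "?l t \<in> \<phi> ` (U \<inter> V)" by (intro image_eqI[of _ _ "c t"]) (simp_all add: cU)
      qed
      show "smooth_on (I \<inter> c -` V) ?l"
        by (rule smooth_on_affine[OF op]) (rule bounded_linear_scaleR_left)
    qed (rule atlas_transition[OF assms(1,2) V])
    then show ?thesis by (simp add: comp_def c_def)
  qed
  ultimately have sc: "smooth_curve A I c" by (auto simp: smooth_curve_def)
  have c0: "c 0 = p" "0 \<in> I" "open I" using ch assms(3) e(1) by (auto simp: c_def I_def)
  have "((\<phi> \<circ> c) has_derivative (\<lambda>t. t *\<^sub>R w)) (at 0)"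
    by (rule has_derivative_transform_within_open[OF _ c0(3,2), of ?l])
      (auto intro!: derivative_eq_intros simp: cU)
  then have "frechet_derivative (\<phi> \<circ> c) (at 0) 1 = w"
    using frechet_derivative_at by (metis scaleR_one)
  then have "u = velocity A I c 0"
    using velocity_chart[OF assms(1,2) _ c0(3,2) sc] c0(1) assms(3) w by simp
  then show "u \<in> tangent_space A p"
    unfolding tangent_space_def using sc c0(1) e(1) unfolding I_def by blast
qed

lemma tangent_space_combination:
  assumes "smooth_atlas A" "u \<in> tangent_space A p" "v \<in> tangent_space A p"
  shows "(\<lambda>f. a * u f + b * v f) \<in> tangent_space A p"
proof -
  obtain U \<phi> where U: "(U, \<phi>) \<in> A" "chart U \<phi>" "p \<in> U" using atlas_cover[OF assms(1)] .
  note T = tangent_space_chart[OF assms(1) U(1,3)]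
  obtain x y where xy: "u = chart_vector A U \<phi> p x" "v = chart_vector A U \<phi> p y"
    using assms(2,3) T by blast
  have "(\<lambda>f. a * u f + b * v f) = chart_vector A U \<phi> p (a *\<^sub>R x + b *\<^sub>R y)"
    using has_derivative_linear[OF smooth_at_chart_derivative[OF assms(1) U(1,3)]]
    by (auto simp: fun_eq_iff xy chart_vector_def linear_add linear_cmul)
  then show ?thesis using T by blast
qed

text \<open>A tangent vector vanishes on functions that are not smooth. For its image under \<open>h\<close> to be a
  tangent vector, \<open>f \<circ> h\<close> may therefore be smooth only if \<open>f\<close> is, which requires a smooth inverse.\<close>

lemma smooth_at_diffeomorphism:
  assumes "smooth_atlas A" "smooth_map A A h" "smooth_map A A h'" "\<And>x. h (h' x) = x" "\<And>x. h' (h x) = x"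
  shows "smooth_at A p (f \<circ> h) \<longleftrightarrow> smooth_at A (h p) f"
proof
  assume "smooth_at A p (f \<circ> h)"
  then have "smooth_at A (h p) ((f \<circ> h) \<circ> h')"
    using smooth_at_pullback[OF assms(1,1,3), of "h p" "f \<circ> h"] assms(5) by simp
  then show "smooth_at A (h p) f" using assms(4) by (simp add: comp_def)
qed (rule smooth_at_pullback[OF assms(1,1,2)])

lemma push_tangent_space:
  assumes "smooth_atlas A" "smooth_map A A h" "smooth_map A A h'" "\<And>x. h (h' x) = x" "\<And>x. h' (h x) = x"
    and "u \<in> tangent_space A p"
  shows "push h u \<in> tangent_space A (h p)"
proof -
  obtain U \<phi> where U: "(U, \<phi>) \<in> A" "chart U \<phi>" "p \<in> U" using atlas_cover[OF assms(1)] .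
  obtain V \<psi> where V: "(V, \<psi>) \<in> A" "chart V \<psi>" "h p \<in> V" using atlas_cover[OF assms(1)] .
  obtain w where w: "u = chart_vector A U \<phi> p w"
    using assms(6) tangent_space_chart[OF assms(1) U(1,3)] by blast
  have opV: "open V" by (rule chartD(1)[OF V(2)])
  have opW: "open (h -` V)" using assms(2) opV by (simp add: smooth_map_def open_vimage)
  have op: "open (\<phi> ` (U \<inter> h -` V))" using chart_open_image[OF U(2) opW] .
  have mem: "\<phi> p \<in> \<phi> ` (U \<inter> h -` V)" using U V by auto
  have "smooth_on (\<phi> ` (U \<inter> h -` V)) (\<psi> \<circ> h \<circ> inv_into U \<phi>)"
    using assms(2) U(1) V(1) by (auto simp: smooth_map_def)
  note d1 = smooth_on_has_derivative[OF op this mem]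
  let ?M = "frechet_derivative (\<psi> \<circ> h \<circ> inv_into U \<phi>) (at (\<phi> p))"
  have "push h u = chart_vector A V \<psi> (h p) (?M w)"
  proof
    fix f
    show "push h u f = chart_vector A V \<psi> (h p) (?M w) f"
    proof (cases "smooth_at A (h p) f")
      case True
      let ?D = "frechet_derivative (f \<circ> inv_into V \<psi>) (at (\<psi> (h p)))"
      note d2 = smooth_at_chart_derivative[OF assms(1) V(1,3) True]
      have "(((f \<circ> inv_into V \<psi>) \<circ> (\<psi> \<circ> h \<circ> inv_into U \<phi>)) has_derivative (?D \<circ> ?M)) (at (\<phi> p))"
        using d1 d2 U by (intro diff_chain_at) auto
      then have "((f \<circ> h \<circ> inv_into U \<phi>) has_derivative (?D \<circ> ?M)) (at (\<phi> p))"
        by (rule has_derivative_transform_within_open[OF _ op mem]) (use U V in auto)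
      then have "?D \<circ> ?M = frechet_derivative (f \<circ> h \<circ> inv_into U \<phi>) (at (\<phi> p))"
        by (rule frechet_derivative_at)
      then show ?thesis using True smooth_at_diffeomorphism[OF assms(1-5)]
        by (simp add: push_def w chart_vector_def) (metis comp_apply)
    qed (simp add: push_def w chart_vector_def smooth_at_diffeomorphism[OF assms(1-5)])
  qed
  then show ?thesis using tangent_space_chart[OF assms(1) V(1,3)] by blast
qed


section \<open>Translations, inversion and invariant vector fields\<close>

lemma has_derivative_slices:
  assumes "(F has_derivative D) (at (a, b))"
  shows "((\<lambda>y. F (y, b)) has_derivative (\<lambda>h. D (h, 0))) (at a)"
    and "((\<lambda>z. F (a, z)) has_derivative (\<lambda>h. D (0, h))) (at b)"
proof -
  have "((\<lambda>y. (y, b)) has_derivative (\<lambda>h. (h, 0))) (at a)" "((\<lambda>z. (a, z)) has_derivative (\<lambda>h. (0, h))) (at b)"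
    by (auto intro!: derivative_eq_intros)
  from this[THEN has_derivative_compose[where g = F]] assms
  show "((\<lambda>y. F (y, b)) has_derivative (\<lambda>h. D (h, 0))) (at a)"
    and "((\<lambda>z. F (a, z)) has_derivative (\<lambda>h. D (0, h))) (at b)"
    by auto
qed

lemma chart_vector_apply:
  assumes "smooth_at A p f" "((f \<circ> inv_into U \<phi>) has_derivative D) (at (\<phi> p))"
  shows "chart_vector A U \<phi> p w f = D w"
  using assms frechet_derivative_at[OF assms(2)] by (simp add: chart_vector_def)

lemma tangent_vector_const:
  assumes "smooth_atlas A" "u \<in> tangent_space A p"
  shows "u (\<lambda>q. c) = 0"
proof -
  obtain U \<phi> where U: "(U, \<phi>) \<in> A" "chart U \<phi>" "p \<in> U" using atlas_cover[OF assms(1)] .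
  obtain w where w: "u = chart_vector A U \<phi> p w"
    using assms(2) tangent_space_chart[OF assms(1) U(1,3)] by blast
  have "(((\<lambda>q. c) \<circ> inv_into U \<phi>) has_derivative (\<lambda>h. 0)) (at (\<phi> p))"
    by (simp add: comp_def)
  then show ?thesis unfolding w by (rule chart_vector_apply[OF smooth_at_const[OF assms(1)]])
qed

lemma vector_fieldD:
  assumes "vector_field A X"
  shows "X p \<in> tangent_space A p" "smooth_at A p f \<Longrightarrow> smooth_at A p (\<lambda>q. X q f)"
  using assms by (auto simp: vector_field_def)

lemma vector_field_add:
  assumes "smooth_atlas A" "vector_field A X" "vector_field A Y"
  shows "vector_field A (\<lambda>q g. X q g + Y q g)"
  unfolding vector_field_def
  using tangent_space_combination[OF assms(1) vector_fieldD(1)[OF assms(2)] vector_fieldD(1)[OF assms(3)], where a = 1 and b = 1]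
    smooth_at_add[OF assms(1) vector_fieldD(2)[OF assms(2)] vector_fieldD(2)[OF assms(3)]]
  by simp

lemma vector_field_scale:
  assumes "smooth_atlas A" "vector_field A X" "\<And>p. smooth_at A p h"
  shows "vector_field A (\<lambda>q g. h q * X q g)"
  unfolding vector_field_def
  using tangent_space_combination[OF assms(1) vector_fieldD(1)[OF assms(2)] vector_fieldD(1)[OF assms(2)], where a = "h _" and b = 0]
    smooth_at_mult[OF assms(1,3) vector_fieldD(2)[OF assms(2)]]
  by simp

locale lie_group_atlas =
  fixes G :: "('g::{t2_space, second_countable_topology}) monoid" (structure)
    and A :: "('g, 'e::euclidean_space) chart set"
  assumes lie_group: "lie_group G A"
begin

lemma atlas: "smooth_atlas A" and smooth_inv: "smooth_map A A (\<lambda>x. inv x)"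
  and smooth_mult: "smooth_map (prod_atlas A A) A (\<lambda>(x, y). x \<otimes> y)"
  and group_G: "group G" and carrier [simp]: "carrier G = UNIV"
  using lie_group by (auto simp: lie_group_def)

lemma group_simps [simp]:
  "\<one> \<otimes> x = x" "x \<otimes> \<one> = x" "inv x \<otimes> x = \<one>" "x \<otimes> inv x = \<one>" "inv (inv x) = x" "inv \<one> = \<one>"
  "x \<otimes> (inv x \<otimes> y) = y" "inv x \<otimes> (x \<otimes> y) = y" "(y \<otimes> x) \<otimes> inv x = y" "(y \<otimes> inv x) \<otimes> x = y"
proof -
  interpret group G by (rule group_G)
  have assoc: "(a \<otimes> b) \<otimes> c = a \<otimes> (b \<otimes> c)" for a b c by (simp add: m_assoc)
  show "\<one> \<otimes> x = x" "x \<otimes> \<one> = x" "inv x \<otimes> x = \<one>" "x \<otimes> inv x = \<one>" "inv (inv x) = x" "inv \<one> = \<one>"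
    by simp_all
  then show "x \<otimes> (inv x \<otimes> y) = y" "inv x \<otimes> (x \<otimes> y) = y" "(y \<otimes> x) \<otimes> inv x = y" "(y \<otimes> inv x) \<otimes> x = y"
    by (simp_all add: assoc[symmetric]) (simp_all add: assoc)
qed

lemma inv_mult: "inv (x \<otimes> y) = inv y \<otimes> inv x"
proof -
  interpret group G by (rule group_G)
  show ?thesis by (simp add: inv_mult_group)
qed

lemma prod_atlas_chart:
  assumes "(U, \<phi>) \<in> A" "(V, \<psi>) \<in> A"
  shows "(U \<times> V, map_prod \<phi> \<psi>) \<in> prod_atlas A A" "chart (U \<times> V) (map_prod \<phi> \<psi>)"
  using assms chart_prod(1)[OF atlas_chart[OF atlas] atlas_chart[OF atlas]] by (auto simp: prod_atlas_def)

lemma smooth_mult_chart: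
  assumes "(U, \<phi>) \<in> A" "(V, \<psi>) \<in> A" "x \<in> U" "y \<in> V" "smooth_at A (x \<otimes> y) f"
  shows "\<exists>S. open S \<and> (\<phi> x, \<psi> y) \<in> S \<and>
    smooth_on S (\<lambda>z. f (inv_into U \<phi> (fst z) \<otimes> inv_into V \<psi> (snd z)))"
proof -
  have im: "map_prod \<phi> \<psi> ` (U \<times> V) = \<phi> ` U \<times> \<psi> ` V" by (auto simp: map_prod_def image_iff)
  obtain S where S: "open S" "map_prod \<phi> \<psi> (x, y) \<in> S" "S \<subseteq> map_prod \<phi> \<psi> ` (U \<times> V)"
    "smooth_on S (f \<circ> (\<lambda>(x, y). x \<otimes> y) \<circ> inv_into (U \<times> V) (map_prod \<phi> \<psi>))"
    using assms by (rule_tac smooth_map_pullback[OF atlas smooth_mult prod_atlas_chart[OF assms(1,2)], of "(x, y)" f]) auto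
  have "smooth_on S (\<lambda>z. f (inv_into U \<phi> (fst z) \<otimes> inv_into V \<psi> (snd z)))"
    by (rule smooth_on_cong[OF S(1,4)])
      (use S(3) chart_prod(2)[OF atlas_chart[OF atlas assms(1)] atlas_chart[OF atlas assms(2)]] in \<open>auto simp: im\<close>)
  with S(1,2) show ?thesis by auto
qed

text \<open>A translation is the multiplication restricted to a slice of the product manifold.\<close>

lemma smooth_translations:
  "smooth_map A A (\<lambda>x. a \<otimes> x)" "smooth_map A A (\<lambda>x. x \<otimes> a)"
proof -
  obtain U0 \<phi>0 where U0: "(U0, \<phi>0) \<in> A" "chart U0 \<phi>0" "a \<in> U0" using atlas_cover[OF atlas] .
  have cm: "continuous_on UNIV (\<lambda>(x, y). x \<otimes> y)" using smooth_mult by (simp add: smooth_map_def)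
  have c: "continuous_on UNIV (\<lambda>x. a \<otimes> x)" "continuous_on UNIV (\<lambda>x. x \<otimes> a)"
    using continuous_on_compose2[OF cm, of UNIV "\<lambda>x. (a, x)"] continuous_on_compose2[OF cm, of UNIV "\<lambda>x. (x, a)"]
      continuous_on_Pair[OF continuous_on_const[of _ a] continuous_on_id[of UNIV]]
      continuous_on_Pair[OF continuous_on_id[of UNIV] continuous_on_const[of _ a]]
    by simp_all
  have "smooth_on (\<phi> ` (U \<inter> (\<lambda>x. a \<otimes> x) -` W)) (\<zeta> \<circ> (\<lambda>x. a \<otimes> x) \<circ> inv_into U \<phi>) \<and>
      smooth_on (\<phi> ` (U \<inter> (\<lambda>x. x \<otimes> a) -` W)) (\<zeta> \<circ> (\<lambda>x. x \<otimes> a) \<circ> inv_into U \<phi>)"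
    if U: "(U, \<phi>) \<in> A" and W: "(W, \<zeta>) \<in> A" for U \<phi> W \<zeta>
  proof
    have ch: "chart U \<phi>" and opW: "open W" using atlas_chart[OF atlas U] chartD(1)[OF atlas_chart[OF atlas W]] .
    have pre: "open ((\<lambda>(x, y). x \<otimes> y) -` W)" using open_vimage[OF opW cm] .
    have op: "open (\<phi> ` (U \<inter> (\<lambda>x. a \<otimes> x) -` W))" "open (\<phi> ` (U \<inter> (\<lambda>x. x \<otimes> a) -` W))"
      using chart_open_image[OF ch] open_vimage[OF opW c(1)] open_vimage[OF opW c(2)] by blast+
    note inv1 = chart_prod(2)[OF U0(2) ch] and inv2 = chart_prod(2)[OF ch U0(2)]
    note op1 = chart_open_image[OF prod_atlas_chart(2)[OF U0(1) U] pre]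
    note op2 = chart_open_image[OF prod_atlas_chart(2)[OF U U0(1)] pre]
    let ?M = "\<lambda>(x, y). x \<otimes> y"
    have s1: "smooth_on (map_prod \<phi>0 \<phi> ` (U0 \<times> U \<inter> ?M -` W)) (\<zeta> \<circ> ?M \<circ> inv_into (U0 \<times> U) (map_prod \<phi>0 \<phi>))"
      using smooth_mult prod_atlas_chart(1)[OF U0(1) U] W unfolding smooth_map_def by fast
    have s2: "smooth_on (map_prod \<phi> \<phi>0 ` (U \<times> U0 \<inter> ?M -` W)) (\<zeta> \<circ> ?M \<circ> inv_into (U \<times> U0) (map_prod \<phi> \<phi>0))"
      using smooth_mult prod_atlas_chart(1)[OF U U0(1)] W unfolding smooth_map_def by fast
    have l: "smooth_on S (\<lambda>z. (\<phi>0 a, z))" "smooth_on S (\<lambda>z. (z, \<phi>0 a))" if "open S" for S :: "'e set"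
      using smooth_on_affine[OF that bounded_linear_Pair[OF bounded_linear_zero bounded_linear_ident], of "(\<phi>0 a, 0)"]
        smooth_on_affine[OF that bounded_linear_Pair[OF bounded_linear_ident bounded_linear_zero], of "(0, \<phi>0 a)"]
      by simp_all
    show "smooth_on (\<phi> ` (U \<inter> (\<lambda>x. a \<otimes> x) -` W)) (\<zeta> \<circ> (\<lambda>x. a \<otimes> x) \<circ> inv_into U \<phi>)"
    proof (rule smooth_on_cong[OF op(1) smooth_on_compose[OF op(1) op1 _ l(1)[OF op(1)] s1]])
      show "(\<lambda>z. (\<phi>0 a, z)) ` \<phi> ` (U \<inter> (\<lambda>x. a \<otimes> x) -` W) \<subseteq> map_prod \<phi>0 \<phi> ` (U0 \<times> U \<inter> ?M -` W)"
      proof (rule image_subsetI)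
        fix z assume "z \<in> \<phi> ` (U \<inter> (\<lambda>x. a \<otimes> x) -` W)"
        then obtain x where "z = \<phi> x" "x \<in> U" "a \<otimes> x \<in> W" by blast
        then show "(\<phi>0 a, z) \<in> map_prod \<phi>0 \<phi> ` (U0 \<times> U \<inter> ?M -` W)"
          using U0(3) by (intro image_eqI[of _ _ "(a, x)"]) simp_all
      qed
    qed (use inv1 U0 in auto)
    show "smooth_on (\<phi> ` (U \<inter> (\<lambda>x. x \<otimes> a) -` W)) (\<zeta> \<circ> (\<lambda>x. x \<otimes> a) \<circ> inv_into U \<phi>)"
    proof (rule smooth_on_cong[OF op(2) smooth_on_compose[OF op(2) op2 _ l(2)[OF op(2)] s2]])
      show "(\<lambda>z. (z, \<phi>0 a)) ` \<phi> ` (U \<inter> (\<lambda>x. x \<otimes> a) -` W) \<subseteq> map_prod \<phi> \<phi>0 ` (U \<times> U0 \<inter> ?M -` W)"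
      proof (rule image_subsetI)
        fix z assume "z \<in> \<phi> ` (U \<inter> (\<lambda>x. x \<otimes> a) -` W)"
        then obtain x where "z = \<phi> x" "x \<in> U" "x \<otimes> a \<in> W" by blast
        then show "(z, \<phi>0 a) \<in> map_prod \<phi> \<phi>0 ` (U \<times> U0 \<inter> ?M -` W)"
          using U0(3) by (intro image_eqI[of _ _ "(x, a)"]) simp_all
      qed
    qed (use inv2 U0 in auto)
  qed
  with c show "smooth_map A A (\<lambda>x. a \<otimes> x)" "smooth_map A A (\<lambda>x. x \<otimes> a)"
    unfolding smooth_map_def by blast+
qed

lemma smooth_at_left_translation:
  "smooth_at A p (\<lambda>x. f (a \<otimes> x)) \<longleftrightarrow> smooth_at A (a \<otimes> p) f"
  using smooth_at_diffeomorphism[OF atlas smooth_translations(1)[of a] smooth_translations(1)[of "inv a"], of p f]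
  by (simp add: comp_def)

lemma smooth_at_right_translation:
  "smooth_at A p (\<lambda>x. f (x \<otimes> a)) \<longleftrightarrow> smooth_at A (p \<otimes> a) f"
  using smooth_at_diffeomorphism[OF atlas smooth_translations(2)[of a] smooth_translations(2)[of "inv a"], of p f]
  by (simp add: comp_def)

lemma smooth_at_inversion: "smooth_at A p (\<lambda>x. f (inv x)) \<longleftrightarrow> smooth_at A (inv p) f"
  using smooth_at_diffeomorphism[OF atlas smooth_inv smooth_inv, of p f] by (simp add: comp_def)

lemma push_inversion_tangent_space: "u \<in> tangent_space A p \<Longrightarrow> push (\<lambda>x. inv x) u \<in> tangent_space A (inv p)"
  using push_tangent_space[OF atlas smooth_inv smooth_inv, of u p] by simp

text \<open>At the identity \<open>f (x \<otimes> y)\<close> has the derivative \<open>D h + D k\<close>, where \<open>D\<close> is that of \<open>f\<close>, because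
  its two slices through the identity are both \<open>f\<close>. Since \<open>f (x \<otimes> inv x)\<close> is constant, inversion
  acts on tangent vectors as \<open>-1\<close>.\<close>

lemma push_inversion_one:
  assumes "u \<in> tangent_space A \<one>"
  shows "push (\<lambda>x. inv x) u = (\<lambda>f. - u f)"
proof
  fix f
  obtain U \<phi> where U: "(U, \<phi>) \<in> A" "chart U \<phi>" "\<one> \<in> U" using atlas_cover[OF atlas] .
  obtain w where w: "u = chart_vector A U \<phi> \<one> w"
    using assms tangent_space_chart[OF atlas U(1,3)] by blast
  have sm: "smooth_at A \<one> (\<lambda>x. f (inv x)) \<longleftrightarrow> smooth_at A \<one> f" using smooth_at_inversion[of \<one> f] by simp
  show "push (\<lambda>x. inv x) u f = - u f"
  proof (cases "smooth_at A \<one> f")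
    case True
    let ?F = "\<lambda>z. f (inv_into U \<phi> (fst z) \<otimes> inv_into U \<phi> (snd z))"
    obtain S where S: "open S" "(\<phi> \<one>, \<phi> \<one>) \<in> S" "smooth_on S ?F"
      using smooth_mult_chart[OF U(1) U(1) U(3) U(3), of f] True unfolding group_simps(1) by blast
    define D where "D = frechet_derivative ?F (at (\<phi> \<one>, \<phi> \<one>))"
    have F: "(?F has_derivative D) (at (\<phi> \<one>, \<phi> \<one>))"
      unfolding D_def by (rule smooth_on_has_derivative[OF S(1,3,2)])
    define Df where "Df = frechet_derivative (f \<circ> inv_into U \<phi>) (at (\<phi> \<one>))"
    have f: "((f \<circ> inv_into U \<phi>) has_derivative Df) (at (\<phi> \<one>))"
      unfolding Df_def by (rule smooth_at_chart_derivative[OF atlas U(1,3) True])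
    have "((f \<circ> inv_into U \<phi>) has_derivative (\<lambda>h. D (h, 0))) (at (\<phi> \<one>))"
      "((f \<circ> inv_into U \<phi>) has_derivative (\<lambda>h. D (0, h))) (at (\<phi> \<one>))"
      using has_derivative_slices[OF F] U by (simp_all add: comp_def)
    then have sl: "D (h, 0) = Df h" "D (0, h) = Df h" for h
      using has_derivative_unique[OF f] by (metis)+
    have D: "D (h, k) = Df h + Df k" for h k
      using linear_add[OF has_derivative_linear[OF F], of "(h, 0)" "(0, k)"] by (simp add: sl)
    define J where "J = frechet_derivative (\<phi> \<circ> (\<lambda>x. inv x) \<circ> inv_into U \<phi>) (at (\<phi> \<one>))"
    have opU: "open ((\<lambda>x. inv x) -` U)"
      using smooth_inv chartD(1)[OF U(2)] by (simp add: smooth_map_def open_vimage)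
    have op: "open (\<phi> ` (U \<inter> (\<lambda>x. inv x) -` U))" by (rule chart_open_image[OF U(2) opU])
    have mem: "\<phi> \<one> \<in> \<phi> ` (U \<inter> (\<lambda>x. inv x) -` U)" using U(3) by auto
    have "smooth_on (\<phi> ` (U \<inter> (\<lambda>x. inv x) -` U)) (\<phi> \<circ> (\<lambda>x. inv x) \<circ> inv_into U \<phi>)"
      using smooth_inv U(1) unfolding smooth_map_def by fast
    then have j: "((\<phi> \<circ> (\<lambda>x. inv x) \<circ> inv_into U \<phi>) has_derivative J) (at (\<phi> \<one>))"
      unfolding J_def by (rule smooth_on_has_derivative[OF op _ mem])
    let ?j = "\<phi> \<circ> (\<lambda>x. inv x) \<circ> inv_into U \<phi>"
    have j1: "?j (\<phi> \<one>) = \<phi> \<one>" using U by simp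
    have "((\<lambda>y. (y, ?j y)) has_derivative (\<lambda>h. (h, J h))) (at (\<phi> \<one>))"
      by (rule has_derivative_Pair[OF has_derivative_ident j])
    from has_derivative_compose[OF this, of ?F D] F
    have "((\<lambda>y. ?F (y, ?j y)) has_derivative (\<lambda>h. D (h, J h))) (at (\<phi> \<one>))"
      by (simp only: j1)
    then have "((\<lambda>y. f \<one>) has_derivative (\<lambda>h. D (h, J h))) (at (\<phi> \<one>))"
      by (rule has_derivative_transform_within_open[OF _ op mem]) (use U in auto)
    then have "D (w, J w) = 0"
      using has_derivative_unique[OF has_derivative_const] by metis
    then have "Df (J w) = - Df w" using D by simp
    moreover have "push (\<lambda>x. inv x) u f = Df (J w)"
    proof -
      have "((f \<circ> inv_into U \<phi>) has_derivative Df) (at (?j (\<phi> \<one>)))" unfolding j1 by (rule f)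
      from diff_chain_at[OF j this]
      have "(((\<lambda>x. f (inv x)) \<circ> inv_into U \<phi>) has_derivative (Df \<circ> J)) (at (\<phi> \<one>))"
        by (rule has_derivative_transform_within_open[OF _ op mem]) (use U in auto)
      from chart_vector_apply[OF _ this] show ?thesis
        using True sm by (simp add: push_def w comp_def)
    qed
    moreover have "u f = Df w" unfolding w by (rule chart_vector_apply[OF True f])
    ultimately show ?thesis by simp
  next
    case False
    then show ?thesis using sm by (simp add: push_def w chart_vector_def comp_def)
  qed
qed

lemma lie_algebraD:
  assumes "X \<in> lie_algebra G A"
  shows "vector_field A X" "X (a \<otimes> p) f = X p (\<lambda>x. f (a \<otimes> x))"
  using assms by (auto simp: lie_algebra_def push_def comp_def)

text \<open>The image of the field under inversion, which exchanges left and right translations.\<close>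

definition reflect :: "('g \<Rightarrow> 'g tvec) \<Rightarrow> 'g \<Rightarrow> 'g tvec" where
  "reflect X p = push (\<lambda>x. inv x) (X (inv p))"

lemma reflect_vector_field:
  assumes "vector_field A X"
  shows "vector_field A (reflect X)"
  unfolding vector_field_def
proof (intro conjI allI impI)
  show "reflect X p \<in> tangent_space A p" for p
    using push_inversion_tangent_space[OF vector_fieldD(1)[OF assms], of "inv p"] by (simp add: reflect_def)
  show "smooth_at A p (\<lambda>q. reflect X q f)" if "smooth_at A p f" for f p
  proof -
    have "smooth_at A (inv p) (\<lambda>x. f (inv x))" using that smooth_at_inversion by simp
    then have "smooth_at A (inv p) (\<lambda>q. X q (\<lambda>x. f (inv x)))" by (rule vector_fieldD(2)[OF assms])
    then show ?thesis
      using smooth_at_inversion[of p "\<lambda>q. X q (\<lambda>x. f (inv x))"] by (simp add: reflect_def push_def comp_def)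
  qed
qed

lemma reflect_right_invariant:
  assumes "X \<in> lie_algebra G A"
  shows "reflect X (p \<otimes> a) = push (\<lambda>x. x \<otimes> a) (reflect X p)"
  using lie_algebraD(2)[OF assms] by (simp add: fun_eq_iff reflect_def push_def comp_def inv_mult)

text \<open>With \<open>x\<close> near the identity and \<open>y\<close> near \<open>p\<close>, a right-invariant field differentiates
  \<open>f (x \<otimes> y)\<close> in \<open>x\<close> and a left-invariant one differentiates it in \<open>y\<close>. Two such fields therefore
  commute by the symmetry of second derivatives.\<close>

lemma left_right_invariant_commute:
  assumes X: "X \<in> lie_algebra G A"
    and R: "vector_field A R" "\<And>p a. R (p \<otimes> a) = push (\<lambda>x. x \<otimes> a) (R p)"
  shows "lie_bracket A X R p f = 0"
proof (cases "smooth_at A p f")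
  case True
  note Xv = lie_algebraD(1)[OF X]
  obtain U \<phi> where U: "(U, \<phi>) \<in> A" "chart U \<phi>" "\<one> \<in> U" using atlas_cover[OF atlas] .
  obtain V \<psi> where V: "(V, \<psi>) \<in> A" "chart V \<psi>" "p \<in> V" using atlas_cover[OF atlas] .
  obtain w where w: "R \<one> = chart_vector A U \<phi> \<one> w"
    using vector_fieldD(1)[OF R(1)] tangent_space_chart[OF atlas U(1,3)] by blast
  obtain v where v: "X p = chart_vector A V \<psi> p v"
    using vector_fieldD(1)[OF Xv] tangent_space_chart[OF atlas V(1,3)] by blast
  have R': "R q g = R \<one> (\<lambda>x. g (x \<otimes> q))" for q g
    using R(2)[of \<one> q] by (simp add: push_def comp_def)
  define F where "F z = f (inv_into U \<phi> (fst z) \<otimes> inv_into V \<psi> (snd z))" for z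
  obtain S where S: "open S" "(\<phi> \<one>, \<psi> p) \<in> S" "smooth_on S F"
    using smooth_mult_chart[OF U(1) V(1) U(3) V(3), of f] True
    unfolding group_simps(1) F_def[abs_def, symmetric] by blast
  define DF where "DF z = frechet_derivative F (at z)" for z
  have DF: "(F has_derivative DF z) (at z)" if "z \<in> S" for z
    unfolding DF_def by (rule smooth_on_has_derivative[OF S(1,3) that])
  define DD where "DD k z = frechet_derivative (\<lambda>z. DF z k) (at z)" for k z
  have DD: "((\<lambda>z. DF z k) has_derivative DD k z) (at z)" if "z \<in> S" for k z
    unfolding DD_def DF_def
    by (rule smooth_on_has_derivative[OF S(1) smooth_on_frechet_derivative(2)[OF S(1,3)] that])
  obtain W where W: "open W" "p \<in> W" "\<And>q. q \<in> W \<Longrightarrow> smooth_at A q f"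
    using True unfolding smooth_at_def by blast
  have Rq: "R q f = DF (\<phi> \<one>, \<psi> q) (w, 0)" if "q \<in> V \<inter> W" "(\<phi> \<one>, \<psi> q) \<in> S" for q
    unfolding R'[of q f] w
  proof (rule chart_vector_apply)
    show "smooth_at A \<one> (\<lambda>x. f (x \<otimes> q))" using that W(3) by (simp add: smooth_at_right_translation)
    show "((\<lambda>x. f (x \<otimes> q)) \<circ> inv_into U \<phi> has_derivative (\<lambda>h. DF (\<phi> \<one>, \<psi> q) (h, 0))) (at (\<phi> \<one>))"
      using has_derivative_slices(1)[OF DF[OF that(2)]] that V(2) by (simp add: F_def comp_def)
  qed
  have Xx: "X (x \<otimes> p) f = DF (\<phi> x, \<psi> p) (0, v)" if "x \<in> U" "x \<otimes> p \<in> W" "(\<phi> x, \<psi> p) \<in> S" for x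
    unfolding lie_algebraD(2)[OF X] v
  proof (rule chart_vector_apply)
    show "smooth_at A p (\<lambda>y. f (x \<otimes> y))" using that W(3) by (simp add: smooth_at_left_translation)
    show "((\<lambda>y. f (x \<otimes> y)) \<circ> inv_into V \<psi> has_derivative (\<lambda>h. DF (\<phi> x, \<psi> p) (0, h))) (at (\<psi> p))"
      using has_derivative_slices(2)[OF DF[OF that(3)]] that U(2) by (simp add: F_def comp_def)
  qed
  have slices: "open ((\<lambda>z. (\<phi> \<one>, z)) -` S)" "open ((\<lambda>y. (y, \<psi> p)) -` S)"
    by (rule open_vimage[OF S(1)]; intro continuous_intros)+
  have "X p (\<lambda>q. R q f) = DD (w, 0) (\<phi> \<one>, \<psi> p) (0, v)"
    unfolding v
  proof (rule chart_vector_apply)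
    show "smooth_at A p (\<lambda>q. R q f)" by (rule vector_fieldD(2)[OF R(1) True])
    have op: "open (\<psi> ` (V \<inter> W) \<inter> (\<lambda>z. (\<phi> \<one>, z)) -` S)"
      using chart_open_image[OF V(2) W(1)] slices(1) by (rule open_Int)
    show "((\<lambda>q. R q f) \<circ> inv_into V \<psi> has_derivative (\<lambda>h. DD (w, 0) (\<phi> \<one>, \<psi> p) (0, h))) (at (\<psi> p))"
      by (rule has_derivative_transform_within_open[OF has_derivative_slices(2)[OF DD[OF S(2)]] op])
        (use V(2,3) W(2) S(2) Rq in auto)
  qed
  moreover have "R p (\<lambda>q. X q f) = DD (0, v) (\<phi> \<one>, \<psi> p) (w, 0)"
    unfolding R'[of p] w
  proof (rule chart_vector_apply)
    show "smooth_at A \<one> (\<lambda>x. X (x \<otimes> p) f)"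
      using smooth_at_right_translation[of \<one> "\<lambda>q. X q f" p] vector_fieldD(2)[OF Xv True] by simp
    have opW: "open ((\<lambda>x. x \<otimes> p) -` W)"
      using smooth_translations(2)[of p] W(1) by (simp add: smooth_map_def open_vimage)
    have op: "open (\<phi> ` (U \<inter> (\<lambda>x. x \<otimes> p) -` W) \<inter> (\<lambda>y. (y, \<psi> p)) -` S)"
      using chart_open_image[OF U(2) opW] slices(2) by (rule open_Int)
    show "((\<lambda>x. X (x \<otimes> p) f) \<circ> inv_into U \<phi> has_derivative (\<lambda>h. DD (0, v) (\<phi> \<one>, \<psi> p) (h, 0))) (at (\<phi> \<one>))"
      by (rule has_derivative_transform_within_open[OF has_derivative_slices(1)[OF DD[OF S(2)]] op])
        (use U(2,3) W(2) S(2) Xx in auto)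
  qed
  moreover have "DD (w, 0) (\<phi> \<one>, \<psi> p) (0, v) = DD (0, v) (\<phi> \<one>, \<psi> p) (w, 0)"
    unfolding DD_def DF_def by (rule symmetric_second_derivative[OF S])
  ultimately show ?thesis using True by (simp add: lie_bracket_def)
qed (simp add: lie_bracket_def)

lemma lie_bracket_left_invariant:
  assumes "X \<in> lie_algebra G A" "Y \<in> lie_algebra G A"
  shows "lie_bracket A X Y (a \<otimes> p) = push (\<lambda>x. a \<otimes> x) (lie_bracket A X Y p)"
  by (simp add: fun_eq_iff lie_bracket_def push_def comp_def smooth_at_left_translation
      lie_algebraD(2)[OF assms(1)] lie_algebraD(2)[OF assms(2)])

end


unbundle cross3_syntax

section \<open>Curves in a three-dimensional Lie algebra\<close>

text \<open>Lagrange's identity makes \<open>T \<times> N\<close> parallel to \<open>B\<close>; the orientation determines the sign.\<close>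

lemma orthonormal_frame_cross:
  fixes T N B :: "real^3"
  assumes "norm T = 1" "norm N = 1" "norm B = 1" "T \<bullet> N = 0" "T \<bullet> B = 0" "N \<bullet> B = 0"
    and "det (vector [T, N, B] :: real^3^3) > 0"
  shows "T \<times> N = B" "N \<times> B = T" "B \<times> T = N"
proof -
  have u: "T \<bullet> T = 1" "N \<bullet> N = 1" "B \<bullet> B = 1"
    using assms(1-3) by (simp_all add: norm_eq_1)
  have d: "det (vector [T, N, B] :: real^3^3) = (T \<times> N) \<bullet> B"
    by (simp add: cross3_simps)
  have "(T \<times> N) \<times> B = 0"
    using cross_cross_det Lagrange[of B T N] assms(5,6) cross_skew[of "T \<times> N" B]
    by (simp add: inner_commute)
  moreover have "norm (T \<times> N) = 1"
    using norm_cross_dot[of T N] assms(1,2,4) by (simp add: power2_eq_1_iff) (use norm_ge_zero[of "T \<times> N"] in linarith)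
  moreover have "norm ((T \<times> N) \<times> B)^2 + ((T \<times> N) \<bullet> B)^2 = (norm (T \<times> N) * norm B)^2"
    by (rule norm_cross_dot)
  ultimately have "((T \<times> N) \<bullet> B)^2 = 1" using assms(3) by simp
  then have "(T \<times> N) \<bullet> B = 1" using assms(7) d by (simp add: power2_eq_1_iff)
  then have "(T \<times> N - B) \<bullet> (T \<times> N - B) = 0"
    using \<open>norm (T \<times> N) = 1\<close> u by (simp add: inner_diff_left inner_diff_right inner_commute norm_eq_1)
  then show B: "T \<times> N = B" by simp
  show "N \<times> B = T" unfolding B[symmetric] using Lagrange[of N T N] u assms(4) by (simp add: inner_commute)
  show "B \<times> T = N" unfolding B[symmetric]
    using Lagrange[of T T N] u assms(4) cross_skew[of "T \<times> N" T] by (simp add: inner_commute)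
qed

text \<open>Up to a factor, the determinant is the only alternating trilinear form on \<open>\<real>\<^sup>3\<close>.\<close>

lemma alternating_structure_constants:
  fixes c :: "3 \<Rightarrow> 3 \<Rightarrow> 3 \<Rightarrow> real"
  assumes "\<And>i j k. c i j k = - c j i k" "\<And>i j k. c i j k = - c i k j"
  shows "(\<Sum>i\<in>UNIV. \<Sum>j\<in>UNIV. (u $ i * v $ j) *\<^sub>R (\<chi> k. c i j k)) = c 1 2 3 *\<^sub>R (u \<times> v)"
proof -
  have z: "c i i k = 0" "c i k k = 0" "c i k i = 0" for i k
    using assms(1)[of i i k] assms(2)[of i k k] assms(2)[of i k i] assms(1)[of i i k] by simp_all
  have e: "c 2 1 3 = - c 1 2 3" "c 1 3 2 = - c 1 2 3" "c 3 1 2 = c 1 2 3" "c 2 3 1 = c 1 2 3"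
    "c 3 2 1 = - c 1 2 3"
    using assms(1)[of 2 1 3] assms(2)[of 1 3 2] assms(1)[of 3 1 2] assms(2)[of 2 3 1]
      assms(1)[of 3 2 1] by simp_all
  show ?thesis
    by (simp add: vec_eq_iff forall_3 sum_3 z e cross3_def algebra_simps)
qed

text \<open>The covariant derivative along a curve with tangent \<open>T\<close> when the bracket is
  \<open>[u, v] = c (u \<times> v)\<close>.\<close>

definition curve_derivative ::
  "real set \<Rightarrow> real \<Rightarrow> (real \<Rightarrow> real^3) \<Rightarrow> (real \<Rightarrow> real^3) \<Rightarrow> real \<Rightarrow> real^3" where
  "curve_derivative I c T U t = vector_derivative U (at t within I) + (c / 2) *\<^sub>R (T t \<times> U t)"

lemma interval_at_within_ne_bot:
  fixes I :: "real set"
  assumes "is_interval I" "interior I \<noteq> {}" "t \<in> I"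
  shows "at t within I \<noteq> bot"
proof -
  have "\<not> I \<subseteq> {t}"
    using assms(2) interior_mono[of I "{t}"] by auto
  then obtain s where "s \<in> I" "s \<noteq> t" by blast
  then show ?thesis
    using connected_imp_perfect[of I t] assms(1,3) is_interval_connected_1[of I]
    by (metis empty_iff insert_iff trivial_limit_within)
qed

text \<open>Comparing the derivatives of \<open>T'\<close> and \<open>N\<close> puts \<open>N'\<close> into the plane of \<open>T\<close> and \<open>B\<close>, with slope
  given by the harmonic curvature, and \<open>B' = N \<times> N'\<close> is \<open>N'\<close> turned by a right angle in that plane.
  In the derivatives of the two coordinates of \<open>N'\<close> all terms along \<open>N\<close> drop out; what remains is a
  rotation with angular velocity \<open>\<tau>' - c / 2\<close>. The slope is written in terms of the two frames,
  whose smoothness makes it differentiable.\<close>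

lemma frenet_mate_slope_derivative:
  fixes T N B T' N' B' :: "real \<Rightarrow> real^3"
  assumes nb: "at t within I \<noteq> bot" and t: "t \<in> I"
    and diff: "T differentiable (at t within I)" "N differentiable (at t within I)"
      "B differentiable (at t within I)" "T' differentiable (at t within I)"
      "N' differentiable (at t within I)"
    and fr: "norm (T t) = 1" "norm (N t) = 1" "norm (B t) = 1"
      "T t \<bullet> N t = 0" "T t \<bullet> B t = 0" "N t \<bullet> B t = 0" "det (vector [T t, N t, B t] :: real^3^3) > 0"
    and fr': "norm (T' t) = 1" "norm (N' t) = 1" "norm (B' t) = 1"
      "T' t \<bullet> N' t = 0" "T' t \<bullet> B' t = 0" "N' t \<bullet> B' t = 0"
      "det (vector [T' t, N' t, B' t] :: real^3^3) > 0"
    and k: "\<kappa> > 0" "\<kappa>' > 0"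
    and eq: "curve_derivative I c T T t = \<kappa> *\<^sub>R N t"
      "curve_derivative I c T N t = - \<kappa> *\<^sub>R T t + \<tau> *\<^sub>R B t"
      "curve_derivative I c T B t = - \<tau> *\<^sub>R N t"
    and eq': "curve_derivative I c T' T' t = \<kappa>' *\<^sub>R N' t"
      "curve_derivative I c T' N' t = - \<kappa>' *\<^sub>R T' t + \<tau>' *\<^sub>R B' t"
    and mate: "\<And>s. s \<in> I \<Longrightarrow> T' s = N s"
  shows "N' t \<bullet> T t < 0"
    and "- (N' t \<bullet> B t) / (N' t \<bullet> T t) = (\<tau> - c / 2) / \<kappa>"
    and "((\<lambda>s. - (N' s \<bullet> B s) / (N' s \<bullet> T s)) has_vector_derivative
      (\<tau>' - c / 2) / (N' t \<bullet> T t)\<^sup>2) (at t within I)"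
proof -
  define \<sigma> \<sigma>' where "\<sigma> = \<tau> - c / 2" and "\<sigma>' = \<tau>' - c / 2"
  note cr = orthonormal_frame_cross[OF fr] and cr' = orthonormal_frame_cross[OF fr']
  let ?D = "\<lambda>U. vector_derivative U (at t within I)"
  have hd: "(U has_vector_derivative ?D U) (at t within I)" if "U differentiable (at t within I)" for U :: "real \<Rightarrow> real^3"
    using that vector_derivative_works by blast
  have cTB: "T t \<times> B t = - N t" using cr(3) cross_skew by metis
  have dT: "?D T = \<kappa> *\<^sub>R N t" using eq(1) by (simp add: curve_derivative_def)
  have dN: "?D N = - \<kappa> *\<^sub>R T t + \<sigma> *\<^sub>R B t"
    using eq(2) by (simp add: curve_derivative_def cr \<sigma>_def algebra_simps)
  have dB: "?D B = - \<sigma> *\<^sub>R N t"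
    using eq(3) by (simp add: curve_derivative_def cTB \<sigma>_def algebra_simps)
  have dT': "?D T' = \<kappa>' *\<^sub>R N' t" using eq'(1) by (simp add: curve_derivative_def)
  have dN': "?D N' = - \<kappa>' *\<^sub>R N t + \<sigma>' *\<^sub>R B' t"
    using eq'(2) cr'(1)
    unfolding curve_derivative_def \<sigma>'_def mate[OF t] by (simp add: algebra_simps)
  have "(T' has_vector_derivative ?D N) (at t within I)"
    using has_vector_derivative_transform[OF t _ hd[OF diff(2)], of T'] mate by simp
  then have "?D T' = ?D N" using vector_derivative_within[OF nb] by blast
  then have N': "\<kappa>' *\<^sub>R N' t = - \<kappa> *\<^sub>R T t + \<sigma> *\<^sub>R B t" using dT' dN by simp
  have u: "T t \<bullet> T t = 1" "N t \<bullet> N t = 1" "B t \<bullet> B t = 1" "N' t \<bullet> N' t = 1"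
    using fr(1-3) fr'(2) by (simp_all add: norm_eq_1)
  have a: "\<kappa>' * (N' t \<bullet> T t) = - \<kappa>" "\<kappa>' * (N' t \<bullet> B t) = \<sigma>"
    using arg_cong[OF N', of "\<lambda>w. w \<bullet> T t"] arg_cong[OF N', of "\<lambda>w. w \<bullet> B t"] u fr(5)
    by (simp_all add: inner_add_left inner_add_right inner_diff_left inner_diff_right inner_commute)
  define p q where "p = N' t \<bullet> T t" and "q = N' t \<bullet> B t"
  have p: "p = - \<kappa> / \<kappa>'" and q: "q = \<sigma> / \<kappa>'"
    using a k by (simp_all add: p_def q_def field_simps)
  show neg: "N' t \<bullet> T t < 0" using p k by (simp add: p_def[symmetric])
  show "- (N' t \<bullet> B t) / (N' t \<bullet> T t) = (\<tau> - c / 2) / \<kappa>"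
    unfolding p_def[symmetric] q_def[symmetric] \<sigma>_def[symmetric] p q using k by simp
  have "\<kappa>' *\<^sub>R B' t = N t \<times> (\<kappa>' *\<^sub>R N' t)"
    using cr'(1) mate[OF t] by (simp add: cross_mult_right)
  also have "\<dots> = \<kappa> *\<^sub>R B t + \<sigma> *\<^sub>R T t"
    unfolding N' using cr cross_skew[of "N t" "T t"]
    by (simp add: cross_add_right cross_mult_right Cross3.right_diff_distrib)
  finally have B': "\<kappa>' *\<^sub>R B' t = \<kappa> *\<^sub>R B t + \<sigma> *\<^sub>R T t" .
  have b: "B' t \<bullet> T t = q" "B' t \<bullet> B t = - p"
    using arg_cong[OF B', of "\<lambda>w. w \<bullet> T t"] arg_cong[OF B', of "\<lambda>w. w \<bullet> B t"] u fr(5) k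
    by (simp_all add: p q inner_add_left inner_add_right inner_commute field_simps)
  have N'N: "N' t \<bullet> N t = 0" using fr'(4) mate[OF t] by (simp add: inner_commute)
  have dp: "((\<lambda>s. N' s \<bullet> T s) has_vector_derivative \<sigma>' * q) (at t within I)"
    using bounded_bilinear.has_vector_derivative[OF bounded_bilinear_inner hd[OF diff(5)] hd[OF diff(1)]]
    using fr(4) by (simp add: dN' dT inner_add_left inner_diff_left inner_add_right inner_diff_right b N'N inner_commute N'N[unfolded inner_commute[of "N' t"]])
  have dq: "((\<lambda>s. N' s \<bullet> B s) has_vector_derivative - \<sigma>' * p) (at t within I)"
    using bounded_bilinear.has_vector_derivative[OF bounded_bilinear_inner hd[OF diff(5)] hd[OF diff(3)]]
    using fr(6) by (simp add: dN' dB inner_add_left inner_diff_left b N'N)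
  have "N' t = p *\<^sub>R T t + q *\<^sub>R B t"
  proof -
    have "\<kappa>' *\<^sub>R N' t = \<kappa>' *\<^sub>R (p *\<^sub>R T t + q *\<^sub>R B t)"
      using k by (simp add: N' p q scaleR_add_right scaleR_diff_right)
    then show ?thesis using k by simp
  qed
  from arg_cong[OF this, of "\<lambda>w. N' t \<bullet> w"] have pq: "p * p + q * q = 1"
    using u by (simp add: inner_add_right p_def q_def)
  have "((\<lambda>s. - (N' s \<bullet> B s) / (N' s \<bullet> T s)) has_real_derivative
      ((\<sigma>' * p) * p - (- q) * (\<sigma>' * q)) / (p * p)) (at t within I)"
    using DERIV_divide[OF DERIV_minus[OF dq[folded has_real_derivative_iff_has_vector_derivative]]
        dp[folded has_real_derivative_iff_has_vector_derivative]] neg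
    by (simp add: p_def[symmetric] q_def[symmetric])
  moreover have "((\<sigma>' * p) * p - (- q) * (\<sigma>' * q)) = \<sigma>' * (p * p + q * q)"
    by (simp add: algebra_simps)
  ultimately show "((\<lambda>s. - (N' s \<bullet> B s) / (N' s \<bullet> T s)) has_vector_derivative
      (\<tau>' - c / 2) / (N' t \<bullet> T t)\<^sup>2) (at t within I)"
    using pq
    by (simp add: has_real_derivative_iff_has_vector_derivative \<sigma>'_def p_def power2_eq_square)
qed

lemma constant_on_interval_iff_derivative_zero:
  fixes h h' :: "real \<Rightarrow> real"
  assumes "is_interval I" "interior I \<noteq> {}"
    and d: "\<And>t. t \<in> I \<Longrightarrow> (h has_vector_derivative h' t) (at t within I)"
  shows "h constant_on I \<longleftrightarrow> (\<forall>t\<in>I. h' t = 0)"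
proof
  assume "h constant_on I"
  then obtain c where c: "\<And>t. t \<in> I \<Longrightarrow> h t = c" by (auto simp: constant_on_def)
  show "\<forall>t\<in>I. h' t = 0"
  proof
    fix t assume t: "t \<in> I"
    have "(h has_vector_derivative 0) (at t within I)"
      by (rule has_vector_derivative_transform[OF t _ has_vector_derivative_const[of c]]) (rule c)
    then show "h' t = 0"
      using vector_derivative_within[OF interval_at_within_ne_bot[OF assms(1,2) t]] d[OF t] by metis
  qed
next
  assume "\<forall>t\<in>I. h' t = 0"
  then have "\<And>t. t \<in> I \<Longrightarrow> (h has_vector_derivative 0) (at t within I)" using d by metis
  then obtain c where "\<And>t. t \<in> I \<Longrightarrow> h t = c"
    using has_vector_derivative_zero_constant is_interval_convex[OF assms(1)] by metis
  then show "h constant_on I" by (auto simp: constant_on_def)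
qed


section \<open>The Levi-Civita connection of a bi-invariant metric\<close>

locale bi_invariant_frame = lie_group_atlas G A
  for G :: "('g::{t2_space, second_countable_topology}) monoid" (structure)
    and A :: "('g, real^3) chart set" +
  fixes m :: "'g metric" and nabla :: "'g connection" and X :: "3 \<Rightarrow> 'g \<Rightarrow> 'g tvec"
  assumes metric: "riemannian_metric A m" and bi_inv: "bi_invariant G A m"
    and connection: "levi_civita A m nabla" and frame: "orthonormal_basis G A m X"
begin

lemma metric_sym: "u \<in> tangent_space A p \<Longrightarrow> v \<in> tangent_space A p \<Longrightarrow> m p u v = m p v u"
  using metric by (simp add: riemannian_metric_def)

lemma metric_combination:
  assumes "u \<in> tangent_space A p" "v \<in> tangent_space A p" "w \<in> tangent_space A p"
  shows "m p (\<lambda>f. a * u f + b * v f) w = a * m p u w + b * m p v w"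
  by (rule metric[unfolded riemannian_metric_def, THEN conjunct2, THEN conjunct1, rule_format, OF assms])

lemma metric_smooth:
  assumes "vector_field A Y" "vector_field A Z"
  shows "smooth_at A p (\<lambda>q. m q (Y q) (Z q))"
  by (rule metric[unfolded riemannian_metric_def, THEN conjunct2, THEN conjunct2, THEN conjunct2, rule_format, OF assms])

lemma metric_sum:
  assumes E: "\<And>i. E i \<in> tangent_space A p" and w: "w \<in> tangent_space A p"
  shows "m p (\<lambda>f. \<Sum>i\<in>(UNIV :: 3 set). y i * E i f) w = (\<Sum>i\<in>UNIV. y i * m p (E i) w)"
proof -
  have "m p (\<lambda>f. 1 * (y 1 * E 1 f + y 2 * E 2 f) + y 3 * E 3 f) w =
      1 * m p (\<lambda>f. y 1 * E 1 f + y 2 * E 2 f) w + y 3 * m p (E 3) w"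
    by (intro metric_combination tangent_space_combination[OF atlas] E w)
  also have "m p (\<lambda>f. y 1 * E 1 f + y 2 * E 2 f) w = y 1 * m p (E 1) w + y 2 * m p (E 2) w"
    by (intro metric_combination E w)
  finally show ?thesis by (simp add: sum_3)
qed

text \<open>In a chart three orthonormal tangent vectors become linearly independent vectors of a
  three-dimensional space, hence a basis of it.\<close>

lemma orthonormal_expansion:
  assumes E: "\<And>i. E i \<in> tangent_space A p" and u: "u \<in> tangent_space A p"
    and orth: "\<And>i j. m p (E i) (E j) = (if i = j then 1 else 0)"
  shows "u = (\<lambda>f. \<Sum>i\<in>(UNIV :: 3 set). m p u (E i) * E i f)"
proof -
  obtain U \<phi> where U: "(U, \<phi>) \<in> A" "chart U \<phi>" "p \<in> U" using atlas_cover[OF atlas] .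
  note T = tangent_space_chart[OF atlas U(1,3)]
  have "\<exists>e. \<forall>i. E i = chart_vector A U \<phi> p (e i)" using E T by (intro choice) blast
  then obtain e where e: "\<And>i. E i = chart_vector A U \<phi> p (e i)" by blast
  obtain w where w: "u = chart_vector A U \<phi> p w" using u T by blast
  define L where "L y = (\<Sum>i\<in>UNIV. y $ i *\<^sub>R e i)" for y :: "real^3"
  have lin: "linear L"
    unfolding L_def by (intro linearI) (simp_all add: scaleR_left_distrib sum.distrib scaleR_sum_right)
  have lc: "chart_vector A U \<phi> p (L y) = (\<lambda>f. \<Sum>i\<in>UNIV. y $ i * E i f)" for y
  proof
    fix f
    show "chart_vector A U \<phi> p (L y) f = (\<Sum>i\<in>UNIV. y $ i * E i f)"
    proof (cases "smooth_at A p f")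
      case True
      note l = has_derivative_linear[OF smooth_at_chart_derivative[OF atlas U(1,3) True]]
      show ?thesis using True
        by (simp add: chart_vector_def e L_def linear_sum[OF l] linear_cmul[OF l])
    qed (simp add: chart_vector_def e)
  qed
  have coord: "m p (chart_vector A U \<phi> p (L y)) (E k) = y $ k" for y k
    unfolding lc metric_sum[OF E E] by (simp add: orth if_distrib cong: if_cong)
  have "inj L"
  proof (rule injI)
    fix x y assume "L x = L y"
    then have "x $ k = y $ k" for k using coord[of x k] coord[of y k] by metis
    then show "x = y" by (simp add: vec_eq_iff)
  qed
  then have "surj L" using linear_injective_imp_surjective[OF lin] by blast
  then obtain y where y: "w = L y" by (metis surjD)
  have "m p u (E k) = y $ k" for k unfolding w y by (rule coord)
  then show ?thesis using lc[of y] by (simp add: w y)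
qed

lemma frame_lie_algebra: "X i \<in> lie_algebra G A"
  using frame by (simp add: orthonormal_basis_def)

lemma frame_field: "vector_field A (X i)"
  by (rule lie_algebraD(1)[OF frame_lie_algebra])

lemma frame_tangent: "X i p \<in> tangent_space A p"
  by (rule vector_fieldD(1)[OF frame_field])

lemma metric_left_invariant:
  assumes "Y (p \<otimes> \<one>) = push (\<lambda>x. p \<otimes> x) (Y \<one>)" "Z (p \<otimes> \<one>) = push (\<lambda>x. p \<otimes> x) (Z \<one>)"
    and "Y \<one> \<in> tangent_space A \<one>" "Z \<one> \<in> tangent_space A \<one>"
  shows "m p (Y p) (Z p) = m \<one> (Y \<one>) (Z \<one>)"
proof -
  have "m (p \<otimes> \<one>) (push (\<lambda>x. p \<otimes> x) (Y \<one>)) (push (\<lambda>x. p \<otimes> x) (Z \<one>)) = m \<one> (Y \<one>) (Z \<one>)"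
    using bi_inv assms(3,4) unfolding bi_invariant_def by blast
  then show ?thesis using assms(1,2) by simp
qed

lemma frame_push: "X i (a \<otimes> p) = push (\<lambda>x. a \<otimes> x) (X i p)"
  using lie_algebraD(2)[OF frame_lie_algebra] by (simp add: fun_eq_iff push_def comp_def)

lemma frame_orthonormal: "m p (X i p) (X j p) = (if i = j then 1 else 0)"
  using metric_left_invariant[of "X i" p "X j", OF frame_push frame_push frame_tangent frame_tangent] frame
  by (simp add: orthonormal_basis_def)

definition right_frame :: "3 \<Rightarrow> 'g \<Rightarrow> 'g tvec" where "right_frame i = reflect (X i)"

lemma right_frame_field: "vector_field A (right_frame i)"
  unfolding right_frame_def by (rule reflect_vector_field[OF frame_field])

lemma right_frame_tangent: "right_frame i p \<in> tangent_space A p"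
  by (rule vector_fieldD(1)[OF right_frame_field])

lemma right_frame_push: "right_frame i (p \<otimes> a) = push (\<lambda>x. x \<otimes> a) (right_frame i p)"
  unfolding right_frame_def by (rule reflect_right_invariant[OF frame_lie_algebra])

lemma right_frame_one: "right_frame i \<one> = (\<lambda>f. - X i \<one> f)"
  using push_inversion_one[OF frame_tangent] by (simp add: right_frame_def reflect_def)

text \<open>At the identity the right-invariant frame is \<open>- X\<close>, and right translations are isometries.\<close>

lemma right_frame_orthonormal: "m p (right_frame i p) (right_frame j p) = (if i = j then 1 else 0)"
proof -
  have neg: "m \<one> (\<lambda>f. - u f) v = - m \<one> u v" if "u \<in> tangent_space A \<one>" "v \<in> tangent_space A \<one>" for u v
    using metric_combination[OF that(1,1,2), of "-1" 0] by simp
  have T: "(\<lambda>f. - X k \<one> f) \<in> tangent_space A \<one>" for k using right_frame_tangent[of k \<one>] by (simp add: right_frame_one)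
  have "m (\<one> \<otimes> p) (push (\<lambda>x. x \<otimes> p) (right_frame i \<one>)) (push (\<lambda>x. x \<otimes> p) (right_frame j \<one>)) = m \<one> (right_frame i \<one>) (right_frame j \<one>)"
    using bi_inv right_frame_tangent unfolding bi_invariant_def by blast
  then have "m p (right_frame i p) (right_frame j p) = m \<one> (right_frame i \<one>) (right_frame j \<one>)" using right_frame_push[of _ \<one> p] by simp
  also have "\<dots> = - m \<one> (X i \<one>) (\<lambda>f. - X j \<one> f)" using neg[OF frame_tangent T] by (simp add: right_frame_one)
  also have "\<dots> = m \<one> (X j \<one>) (X i \<one>)"
    using neg[OF frame_tangent frame_tangent] metric_sym[OF frame_tangent T] by simp
  finally show ?thesis by (simp add: frame_orthonormal)
qed

lemma nabla_tangent:
  assumes "vector_field A Y" "vector_field A Z"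
  shows "nabla Y Z p \<in> tangent_space A p"
  using connection[unfolded levi_civita_def, THEN conjunct1, rule_format, OF assms]
  by (intro vector_fieldD(1)) (rule conjunct1)

lemma torsion_free:
  assumes "vector_field A Y" "vector_field A Z"
  shows "nabla Y Z p f - nabla Z Y p f = lie_bracket A Y Z p f"
  using connection[unfolded levi_civita_def, THEN conjunct1, rule_format, OF assms, THEN conjunct2]
  by (elim allE)

lemma metric_compatible:
  assumes "vector_field A Y" "vector_field A Z" "vector_field A W"
  shows "Y p (\<lambda>q. m q (Z q) (W q)) = m p (nabla Y Z p) (W p) + m p (Z p) (nabla Y W p)"
  by (rule connection[unfolded levi_civita_def, THEN conjunct2, THEN conjunct2, rule_format, OF assms])

lemma nabla_add_left:
  assumes "vector_field A Y" "vector_field A W" "vector_field A Z"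
  shows "nabla (\<lambda>q g. Y q g + W q g) Z p f = nabla Y Z p f + nabla W Z p f"
  using connection[unfolded levi_civita_def, THEN conjunct2, THEN conjunct1, rule_format,
      OF assms smooth_at_const[OF atlas, where c = 0]] by blast

lemma nabla_scale_left:
  assumes "vector_field A Y" "vector_field A Z" "\<And>p. smooth_at A p h"
  shows "nabla (\<lambda>q g. h q * Y q g) Z p f = h p * nabla Y Z p f"
  using connection[unfolded levi_civita_def, THEN conjunct2, THEN conjunct1, rule_format,
      OF assms(1,1,2,3)] by blast

lemma nabla_sum_left:
  assumes Y: "\<And>i. vector_field A (Y i)" and Z: "vector_field A Z" and h: "\<And>i p. smooth_at A p (h i)"
  shows "nabla (\<lambda>q g. \<Sum>i\<in>(UNIV :: 3 set). h i q * Y i q g) Z p f = (\<Sum>i\<in>UNIV. h i p * nabla (Y i) Z p f)"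
proof -
  note F = vector_field_scale[OF atlas Y h]
  show ?thesis
    unfolding sum_3
    by (simp add: nabla_add_left[OF vector_field_add[OF atlas F F] F Z] nabla_add_left[OF F F Z]
        nabla_scale_left[OF Y Z h])
qed

definition christoffel :: "'g \<Rightarrow> 3 \<Rightarrow> 3 \<Rightarrow> 3 \<Rightarrow> real" where
  "christoffel p i j k = m p (nabla (X i) (X j) p) (X k p)"

text \<open>The inner products of left-invariant fields are constant.\<close>

lemma christoffel_skew_last: "christoffel p i j k = - christoffel p i k j"
proof -
  have "X i p (\<lambda>q. m q (X j q) (X k q)) = 0"
    by (simp add: frame_orthonormal tangent_vector_const[OF atlas frame_tangent])
  then show ?thesis
    using metric_compatible[OF frame_field frame_field frame_field, of i p j k]
      metric_sym[OF frame_tangent[of j p] nabla_tangent[OF frame_field frame_field, of i k p]]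
    by (simp add: christoffel_def)
qed

text \<open>The flow of a left-invariant field consists of right translations, which are isometries, so
  the field is Killing: its covariant derivative is skew. In the right-invariant orthonormal frame
  this needs no flow. The frame commutes with \<open>X i\<close>, so the connection being torsion-free exchanges
  the derivatives of \<open>X i\<close> along the frame for those of the frame along \<open>X i\<close>, and these are skew
  because the frame has constant inner products. Tensoriality carries the result over to \<open>X\<close>.\<close>

lemma christoffel_skew_outer: "christoffel p j i k = - christoffel p k i j"
proof -
  define r where "r j a q = m q (X j q) (right_frame a q)" for j a q
  have r: "smooth_at A q (r j a)" for j a q
    unfolding r_def[abs_def] by (rule metric_smooth[OF frame_field right_frame_field])
  have XR: "X j q = (\<lambda>f. \<Sum>a\<in>UNIV. r j a q * right_frame a q f)" for j q
    unfolding r_def by (rule orthonormal_expansion[OF right_frame_tangent frame_tangent right_frame_orthonormal])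
  define Q where "Q a b = m p (nabla (right_frame a) (X i) p) (right_frame b p)" for a b
  have Q: "Q a b + Q b a = 0" for a b
  proof -
    have "nabla (right_frame a) (X i) p = nabla (X i) (right_frame a) p" for a
      using torsion_free[OF frame_field right_frame_field, of i a p]
        left_right_invariant_commute[OF frame_lie_algebra right_frame_field right_frame_push, of i a p]
      by (auto simp: fun_eq_iff)
    moreover have "X i p (\<lambda>q. m q (right_frame a q) (right_frame b q)) = 0"
      by (simp add: right_frame_orthonormal tangent_vector_const[OF atlas frame_tangent])
    ultimately show ?thesis
      using metric_compatible[OF frame_field right_frame_field right_frame_field, of i p a b]
        metric_sym[OF right_frame_tangent[of a p] nabla_tangent[OF frame_field right_frame_field, of i b p]]
      by (simp add: Q_def)
  qed
  have "christoffel p j i k = (\<Sum>a\<in>UNIV. \<Sum>b\<in>UNIV. r j a p * r k b p * Q a b)" for j k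
  proof -
    have "X j = (\<lambda>q g. \<Sum>a\<in>UNIV. r j a q * right_frame a q g)" using XR by (simp add: fun_eq_iff)
    then have "nabla (X j) (X i) p f = nabla (\<lambda>q g. \<Sum>a\<in>UNIV. r j a q * right_frame a q g) (X i) p f" for f
      by (rule arg_cong)
    then have n: "nabla (X j) (X i) p = (\<lambda>f. \<Sum>a\<in>UNIV. r j a p * nabla (right_frame a) (X i) p f)"
      unfolding nabla_sum_left[OF right_frame_field frame_field r] by (rule ext)
    have nT: "nabla (right_frame a) (X i) p \<in> tangent_space A p" for a by (rule nabla_tangent[OF right_frame_field frame_field])
    have "m p (nabla (right_frame a) (X i) p) (X k p) = (\<Sum>b\<in>UNIV. r k b p * Q a b)" for a
    proof -
      have "m p (nabla (right_frame a) (X i) p) (X k p) = m p (X k p) (nabla (right_frame a) (X i) p)"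
        by (rule metric_sym[OF nT frame_tangent])
      also have "\<dots> = (\<Sum>b\<in>UNIV. r k b p * m p (right_frame b p) (nabla (right_frame a) (X i) p))"
        using arg_cong[OF XR[of k p], of "\<lambda>u. m p u (nabla (right_frame a) (X i) p)"]
        by (simp only: metric_sum[OF right_frame_tangent nT])
      finally show ?thesis using metric_sym[OF right_frame_tangent nT] by (simp add: Q_def)
    qed
    then show ?thesis
      unfolding christoffel_def n metric_sum[OF nT frame_tangent]
      by (simp add: sum_distrib_left mult.assoc)
  qed
  note c = this
  have "christoffel p k i j = (\<Sum>a\<in>UNIV. \<Sum>b\<in>UNIV. r k b p * r j a p * Q b a)"
    unfolding c by (rule sum.swap)
  then have "christoffel p j i k + christoffel p k i j =
      (\<Sum>a\<in>UNIV. \<Sum>b\<in>UNIV. r j a p * r k b p * (Q a b + Q b a))"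
    unfolding c[of j k] by (simp add: sum.distrib[symmetric] algebra_simps)
  then show ?thesis by (simp add: Q)
qed

definition structure_constant :: "3 \<Rightarrow> 3 \<Rightarrow> 3 \<Rightarrow> real" where
  "structure_constant i j k = m \<one> (lie_bracket A (X i) (X j) \<one>) (X k \<one>)"

lemma frame_bracket: "lie_bracket A (X i) (X j) p = (\<lambda>f. 1 * nabla (X i) (X j) p f + (-1) * nabla (X j) (X i) p f)"
  using torsion_free[OF frame_field frame_field, of i j p] by (auto simp: fun_eq_iff)

lemma frame_bracket_tangent: "lie_bracket A (X i) (X j) p \<in> tangent_space A p"
  unfolding frame_bracket
  by (rule tangent_space_combination[OF atlas nabla_tangent[OF frame_field frame_field] nabla_tangent[OF frame_field frame_field]])

text \<open>The two antisymmetries make the coefficients of the connection alternating in all three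
  indices, so that the bracket is twice the covariant derivative.\<close>

lemma christoffel_eq: "christoffel p i j k = structure_constant i j k / 2"
proof -
  have "structure_constant i j k = m p (lie_bracket A (X i) (X j) p) (X k p)"
    unfolding structure_constant_def
    using metric_left_invariant[of "lie_bracket A (X i) (X j)" p "X k",
        OF lie_bracket_left_invariant[OF frame_lie_algebra frame_lie_algebra]
          frame_push frame_bracket_tangent frame_tangent] by simp
  also have "\<dots> = christoffel p i j k - christoffel p j i k"
    unfolding frame_bracket christoffel_def
    using metric_combination[OF nabla_tangent[OF frame_field frame_field] nabla_tangent[OF frame_field frame_field]
        frame_tangent, where a = 1 and b = "-1"] by simp
  also have "christoffel p j i k = - christoffel p i j k"
    using christoffel_skew_outer[of p j i k] christoffel_skew_last[of p k i j] christoffel_skew_outer[of p k j i]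
      christoffel_skew_last[of p i j k] by simp
  finally show ?thesis by simp
qed

lemma structure_constant_alternating:
  "structure_constant i j k = - structure_constant j i k"
  "structure_constant i j k = - structure_constant i k j"
  using christoffel_skew_last[of \<one> i j k] christoffel_skew_outer[of \<one> j i k] christoffel_skew_last[of \<one> k i j]
    christoffel_skew_outer[of \<one> k j i]
  by (simp_all add: christoffel_eq)

lemma bracket_cross: "bracket G A m X u v = structure_constant 1 2 3 *\<^sub>R (u \<times> v)"
  unfolding bracket_def coords_def structure_constant_def[symmetric]
  by (rule alternating_structure_constants[OF structure_constant_alternating])

lemma covariant_derivative_cross:
  "covariant_derivative m nabla X I c T U t = curve_derivative I (structure_constant 1 2 3) T U t"
proof -
  have "coords m X (c t) (nabla (X i) (X j) (c t)) = (\<chi> k. structure_constant i j k / 2)" for i j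
    using christoffel_eq by (simp add: coords_def christoffel_def vec_eq_iff)
  moreover have "(\<Sum>i\<in>UNIV. \<Sum>j\<in>UNIV. (T t $ i * U t $ j) *\<^sub>R (\<chi> k. structure_constant i j k / 2)) =
      (structure_constant 1 2 3 / 2) *\<^sub>R (T t \<times> U t)"
  proof (rule alternating_structure_constants[of "\<lambda>i j k. structure_constant i j k / 2"])
    show "structure_constant i j k / 2 = - (structure_constant j i k / 2)" for i j k
      using structure_constant_alternating(1)[of i j k] by simp
    show "structure_constant i j k / 2 = - (structure_constant i k j / 2)" for i j k
      using structure_constant_alternating(2)[of i j k] by simp
  qed
  ultimately show ?thesis by (simp add: covariant_derivative_def curve_derivative_def)
qed

lemma lie_torsion_eq:
  assumes "frenet_apparatus A m nabla X I c T N B \<kappa> \<tau>" "t \<in> I"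
  shows "lie_torsion G A m X T N B t = structure_constant 1 2 3 / 2"
proof -
  have "T t \<times> N t = B t" "norm (B t) = 1"
    using assms orthonormal_frame_cross(1)[of "T t" "N t" "B t"] unfolding frenet_apparatus_def by blast+
  then show ?thesis by (simp add: lie_torsion_def bracket_cross norm_eq_1)
qed

end

section \<open>Natural mates of general helices\<close>

theorem corollary3p1:
  fixes G :: "('g::{t2_space, second_countable_topology}) monoid"
    and A :: "('g, real^3) chart set"
    and m :: "'g metric"
    and nabla :: "'g connection"
    and X :: "3 \<Rightarrow> 'g \<Rightarrow> 'g tvec"
    and I :: "real set"
    and \<gamma> \<beta> :: "real \<Rightarrow> 'g"
    and T N B T' N' B' :: "real \<Rightarrow> real^3"
    and \<kappa> \<tau> \<kappa>' \<tau>' :: "real \<Rightarrow> real"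
  assumes "lie_group G A"
    and "riemannian_metric A m" and "bi_invariant G A m"
    and "levi_civita A m nabla"
    and "orthonormal_basis G A m X"
    and "is_interval I" and "interior I \<noteq> {}"
    and "frenet_curve A m nabla X I \<gamma> T N B \<kappa> \<tau>"
    and "natural_mate A m nabla X I N \<beta> T' N' B' \<kappa>' \<tau>'"
  shows "general_helix G A m X I T N B \<kappa> \<tau> \<longleftrightarrow>
         (\<forall>t\<in>I. \<tau>' t - lie_torsion G A m X T' N' B' t = 0)"
proof -
  interpret bi_invariant_frame G A m nabla X
    using assms(1-5) by unfold_locales
  define c where "c = structure_constant 1 2 3"
  have fr: "frenet_apparatus A m nabla X I \<gamma> T N B \<kappa> \<tau>"
    using assms(8) by (simp add: frenet_curve_def)
  have fr': "frenet_apparatus A m nabla X I \<beta> T' N' B' \<kappa>' \<tau>'" and mate: "\<And>t. t \<in> I \<Longrightarrow> T' t = N t"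
    using assms(9) by (simp_all add: natural_mate_def)
  have diff: "U differentiable (at t within I)" if "smooth_on I U" "t \<in> I" for U :: "real \<Rightarrow> real^3" and t
  proof -
    have "Ck_on (Suc 0) I U" using that(1) by (simp only: smooth_on_def)
    then show ?thesis using that(2) by (simp add: differentiable_on_def)
  qed
  \<comment> \<open>The harmonic curvature of \<open>\<gamma>\<close>, in terms of the frames of both curves.\<close>
  define h where "h t = - (N' t \<bullet> B t) / (N' t \<bullet> T t)" for t
  have "N' t \<bullet> T t < 0 \<and> h t = (\<tau> t - c / 2) / \<kappa> t \<and>
      (h has_vector_derivative (\<tau>' t - c / 2) / (N' t \<bullet> T t)\<^sup>2) (at t within I)" if t: "t \<in> I" for t
  proof -
    have T: "smooth_on I T" "smooth_on I N" "smooth_on I B" "smooth_on I T'" "smooth_on I N'"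
      using fr fr' by (simp_all only: frenet_apparatus_def)
    note F = fr[unfolded frenet_apparatus_def covariant_derivative_cross, folded c_def,
        THEN conjunct2, THEN conjunct2, THEN conjunct2, THEN conjunct2, rule_format, OF t]
    note F' = fr'[unfolded frenet_apparatus_def covariant_derivative_cross, folded c_def,
        THEN conjunct2, THEN conjunct2, THEN conjunct2, THEN conjunct2, rule_format, OF t]
    note S = frenet_mate_slope_derivative[OF interval_at_within_ne_bot[OF assms(6,7) t] t
        T[THEN diff, OF t], of B' "\<kappa> t" "\<kappa>' t" c "\<tau> t" "\<tau>' t"]
    have "N' t \<bullet> T t < 0" by (rule S(1)) (use F F' mate in \<open>blast+\<close>)
    moreover have "- (N' t \<bullet> B t) / (N' t \<bullet> T t) = (\<tau> t - c / 2) / \<kappa> t"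
      by (rule S(2)) (use F F' mate in \<open>blast+\<close>)
    moreover have "((\<lambda>s. - (N' s \<bullet> B s) / (N' s \<bullet> T s)) has_vector_derivative
      (\<tau>' t - c / 2) / (N' t \<bullet> T t)\<^sup>2) (at t within I)"
      by (rule S(3)) (use F F' mate in \<open>blast+\<close>)
    ultimately show ?thesis by (simp add: h_def[abs_def])
  qed
  note h = this
  have "harmonic_curvature G A m X T N B \<kappa> \<tau> t = h t" if "t \<in> I" for t
    using h[OF that] lie_torsion_eq[OF fr that] by (simp add: harmonic_curvature_def c_def)
  then have "general_helix G A m X I T N B \<kappa> \<tau> \<longleftrightarrow> h constant_on I"
    by (simp add: general_helix_def constant_on_def)
  also have "\<dots> \<longleftrightarrow> (\<forall>t\<in>I. (\<tau>' t - c / 2) / (N' t \<bullet> T t)\<^sup>2 = 0)"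
    by (rule constant_on_interval_iff_derivative_zero[OF assms(6,7)]) (use h in blast)
  also have "\<dots> \<longleftrightarrow> (\<forall>t\<in>I. \<tau>' t - lie_torsion G A m X T' N' B' t = 0)"
  proof (intro ball_cong refl)
    fix t assume "t \<in> I"
    then show "(\<tau>' t - c / 2) / (N' t \<bullet> T t)\<^sup>2 = 0 \<longleftrightarrow> \<tau>' t - lie_torsion G A m X T' N' B' t = 0"
      using h[of t] by (auto simp: lie_torsion_eq[OF fr'] c_def)
  qed
  finally show ?thesis .
qed

end
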